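(* Let $G$ be a finite connected network with states $1,\dots,N$ and edge set $\mathcal{E}$, carrying a Markov jump process with rates $w_{\pm e}>0$ as described in the context. Let $A$ be a finite index set of physical currents $\jmath_\alpha=\sum_{e}d^\alpha_{e}\,\jmath_{e}$, $\alpha\in A$, with real increments $d^\alpha_e$, let $\mathcal{E}_\alpha=\{e\in\mathcal{E}: d^\alpha_e\neq 0\}$ be the support of $\jmath_\alpha$, and write $\mathcal{E}'=\bigcup_{\alpha\in A}\mathcal{E}_\alpha=\{e_1,\dots,e_M\}$. Let $h=(h_\alpha)_{\alpha\in A}\in\mathbb{R}^A$ be the conjugate forces, and suppose the rates depend on $h$ as follows: (i) (locality) for $e\in\mathcal{E}\setminus\mathcal{E}'$ the rates $w_{\pm e}$ do not depend on $h$; (ii) (local detailed balance/conjugacy) for $\mu=1,\dots,M$ the rates $w_{\pm e_\mu}$ are functions of $h$ only through the single variable $x_\mu=x_\mu(h):=\sum_{\alpha\in A}d^\alpha_{e_\mu}h_\alpha$, where $w_{\pm e_\mu}=w_{\pm e_\mu}(x_\mu)>0$ are differentiable functions of $x_\mu\in\mathbb{R}$ satisfying $$\frac{d}{dx_\mu}\ln\frac{w_{+e_\mu}(x_\mu)}{w_{-e_\mu}(x_\mu)}=1 .$$ Let $h^\star\in\mathbb{R}^A$ be a value of the forces at which all the contributing edge currents vanish in the steady state, i.e. $J_{e_\mu}(h^\star)=0$ for all $\mu=1,\dots,M$ (internal stalling). Then for all $\alpha,\alpha'\in A$, $$2\,D_{\alpha,\alpha'}(h^\star)=\partial_{h_{\alpha'}}J_\alpha(h^\star)+\partial_{h_\alpha}J_{\alpha'}(h^\star).$$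 In particular, for each $\alpha\in A$, $\partial_{h_\alpha}J_\alpha(h^\star)=D_{\alpha,\alpha}(h^\star)$.
   Context: Setting. The network is a finite connected graph with vertices (states) $1,\dots,N$; several edges between the same two distinct vertices are allowed, there are no self-loops, and each edge $e\in\mathcal{E}$ has an arbitrary fixed orientation, with source $\sigma(e)$ and target $\tau(e)$. A transition along $+e$ (from $\sigma(e)$ to $\tau(e)$) occurs at rate $w_{+e}>0$ and along $-e$ (from $\tau(e)$ to $\sigma(e)$) at rate $w_{-e}>0$. Here the rates depend on parameters $h$. Tilted generator. For a subset $\mathcal{E}'=\{e_1,\dots,e_M\}$ of edges and counting variables $\mathbf{q}=(q_1,\dots,q_M)\in\mathbb{R}^M$, put $q_e=q_\mu$ if $e=e_\mu$ and $q_e=0$ if $e\notin\mathcal{E}'$. The tilted generator $\mathbb{W}(\mathbf{q};h)$ is the $N\times N$ matrix with off-diagonal entries ($l\neq m$) $$\mathbb{W}(\mathbf{q};h)_{l,m}=\sum_{e:\,\sigma(e)=m,\,\tau(e)=l}w_{+e}\,e^{q_e}+\sum_{e:\,\tau(e)=m,\,\sigma(e)=l}w_{-e}\,e^{-q_e}$$ and diagonal entries $-\left(\sum_{e:\,\sigma(e)=n}w_{+e}+\sum_{e:\,\tau(e)=n}w_{-e}\right)$ (minus the total exit rate from $n$, not tilted). At $\mathbf{q}=0$ it is the generator of the Markov jump process (acting on column probability vectors). Scaled cumulant generating function. $\lambda(\mathbf{q};h)$ denotes the dominant (Perron) eigenvalue of $\mathbb{W}(\mathbf{q};h)$, i.e.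 its simple real eigenvalue of largest real part. The steady-state edge currents and edge diffusivities are $$J_{e_\mu}=\left.\frac{\partial\lambda}{\partial q_\mu}\right|_{\mathbf{q}=0},\qquad D_{e_\mu,e_\nu}=\frac12\left.\frac{\partial^2\lambda}{\partial q_\mu\partial q_\nu}\right|_{\mathbf{q}=0}.$$ Physical currents. The steady-state average and the generalized diffusion constants of the physical currents are, by multilinearity of cumulants, $$J_\alpha=\sum_{\mu}d^\alpha_{e_\mu}J_{e_\mu},\qquad D_{\alpha,\alpha'}=\sum_{\mu,\nu}d^\alpha_{e_\mu}d^{\alpha'}_{e_\nu}D_{e_\mu,e_\nu}.$$ *)

theory Defs
  imports
    "HOL-Analysis.Analysis"
    "Jordan_Normal_Form.Char_Poly"
    "Graph_Theory.Digraph_Component"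
begin

text \<open>
  A network is a directed multigraph whose vertices are the states and whose arcs are the edges,
  with \<open>tail G e\<close> the source and \<open>head G e\<close> the target in the chosen (arbitrary) orientation.
  Its states are numbered \<open>0, \<dots>, N - 1\<close> to agree with the matrix indices of \<open>'a mat\<close>.
  Connectedness is that of the underlying undirected graph and entails \<open>N > 0\<close>.
\<close>
definition network :: "nat \<Rightarrow> (nat, 'e) pre_digraph \<Rightarrow> bool" where
  "network N G \<longleftrightarrow>
     fin_digraph G \<and> loopfree_digraph G \<and> verts G = {..<N} \<and> Digraph_Component.connected G"

text \<open>
  The argument \<open>E'\<close> is the set of edges that are counted. Counting variables are stored in a
  function on all edges, of which only the values on \<open>E'\<close> are used. The functions \<open>wp\<close> and \<open>wm\<close>
  give the rates along \<open>+e\<close> and \<open>-e\<close>.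
\<close>
definition counting_variable :: "'e set \<Rightarrow> ('e \<Rightarrow> real) \<Rightarrow> 'e \<Rightarrow> real" where
  "counting_variable E' q e = (if e \<in> E' then q e else 0)"

definition tilted_generator ::
    "nat \<Rightarrow> (nat, 'e) pre_digraph \<Rightarrow> 'e set \<Rightarrow> ('e \<Rightarrow> real) \<Rightarrow> ('e \<Rightarrow> real) \<Rightarrow> ('e \<Rightarrow> real) \<Rightarrow> real mat"
  where
  "tilted_generator N G E' wp wm q = mat N N (\<lambda>(l, m).
     if l \<noteq> m then
       (\<Sum>e | e \<in> arcs G \<and> tail G e = m \<and> head G e = l. wp e * exp (counting_variable E' q e)) +
       (\<Sum>e | e \<in> arcs G \<and> head G e = m \<and> tail G e = l. wm e * exp (- counting_variable E' q e))
     else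
       - ((\<Sum>e | e \<in> arcs G \<and> tail G e = m. wp e) + (\<Sum>e | e \<in> arcs G \<and> head G e = m. wm e)))"

text \<open>
  Simplicity is algebraic multiplicity one; the real parts are compared over the complex spectrum.
  At most one real number satisfies this predicate.
\<close>
definition is_dominant_eigenvalue :: "real mat \<Rightarrow> real \<Rightarrow> bool" where
  "is_dominant_eigenvalue W l \<longleftrightarrow>
     eigenvalue W l \<and> Polynomial.order l (char_poly W) = 1 \<and>
     (\<forall>z. eigenvalue (map_mat complex_of_real W) z \<longrightarrow> Re z \<le> l)"

definition dominant_eigenvalue :: "real mat \<Rightarrow> real" where
  "dominant_eigenvalue W = (THE l. is_dominant_eigenvalue W l)"

definition scgf ::
    "nat \<Rightarrow> (nat, 'e) pre_digraph \<Rightarrow> 'e set \<Rightarrow> ('e \<Rightarrow> real) \<Rightarrow> ('e \<Rightarrow> real) \<Rightarrow> ('e \<Rightarrow> real) \<Rightarrow> real"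
  where
  "scgf N G E' wp wm q = dominant_eigenvalue (tilted_generator N G E' wp wm q)"

definition partial_deriv :: "'i \<Rightarrow> (('i \<Rightarrow> real) \<Rightarrow> real) \<Rightarrow> ('i \<Rightarrow> real) \<Rightarrow> real" where
  "partial_deriv i f x = deriv (\<lambda>t. f (x(i := t))) (x i)"

definition partially_differentiable :: "'i \<Rightarrow> (('i \<Rightarrow> real) \<Rightarrow> real) \<Rightarrow> ('i \<Rightarrow> real) \<Rightarrow> bool" where
  "partially_differentiable i f x \<longleftrightarrow> (\<lambda>t. f (x(i := t))) differentiable (at (x i))"

definition edge_current ::
    "nat \<Rightarrow> (nat, 'e) pre_digraph \<Rightarrow> 'e set \<Rightarrow> ('e \<Rightarrow> real) \<Rightarrow> ('e \<Rightarrow> real) \<Rightarrow> 'e \<Rightarrow> real"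
  where
  "edge_current N G E' wp wm e = partial_deriv e (scgf N G E' wp wm) (\<lambda>_. 0)"

definition edge_diffusivity ::
    "nat \<Rightarrow> (nat, 'e) pre_digraph \<Rightarrow> 'e set \<Rightarrow> ('e \<Rightarrow> real) \<Rightarrow> ('e \<Rightarrow> real) \<Rightarrow> 'e \<Rightarrow> 'e \<Rightarrow> real"
  where
  "edge_diffusivity N G E' wp wm e e' =
     1 / 2 * partial_deriv e (partial_deriv e' (scgf N G E' wp wm)) (\<lambda>_. 0)"

text \<open>\<open>d \<alpha> e\<close> is the increment of the physical current \<open>\<alpha>\<close> along the edge \<open>e\<close>.\<close>

definition current_support :: "(nat, 'e) pre_digraph \<Rightarrow> ('a \<Rightarrow> 'e \<Rightarrow> real) \<Rightarrow> 'a \<Rightarrow> 'e set" where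
  "current_support G d \<alpha> = {e \<in> arcs G. d \<alpha> e \<noteq> 0}"

definition contributing_edges ::
    "(nat, 'e) pre_digraph \<Rightarrow> 'a set \<Rightarrow> ('a \<Rightarrow> 'e \<Rightarrow> real) \<Rightarrow> 'e set" where
  "contributing_edges G A d = (\<Union>\<alpha>\<in>A. current_support G d \<alpha>)"

definition physical_current ::
    "nat \<Rightarrow> (nat, 'e) pre_digraph \<Rightarrow> 'a set \<Rightarrow> ('a \<Rightarrow> 'e \<Rightarrow> real) \<Rightarrow>
     ('e \<Rightarrow> real) \<Rightarrow> ('e \<Rightarrow> real) \<Rightarrow> 'a \<Rightarrow> real"
  where
  "physical_current N G A d wp wm \<alpha> =
     (let E' = contributing_edges G A d in
      \<Sum>e\<in>E'. d \<alpha> e * edge_current N G E' wp wm e)"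

definition physical_diffusion ::
    "nat \<Rightarrow> (nat, 'e) pre_digraph \<Rightarrow> 'a set \<Rightarrow> ('a \<Rightarrow> 'e \<Rightarrow> real) \<Rightarrow>
     ('e \<Rightarrow> real) \<Rightarrow> ('e \<Rightarrow> real) \<Rightarrow> 'a \<Rightarrow> 'a \<Rightarrow> real"
  where
  "physical_diffusion N G A d wp wm \<alpha> \<alpha>' =
     (let E' = contributing_edges G A d in
      \<Sum>e\<in>E'. \<Sum>e'\<in>E'. d \<alpha> e * d \<alpha>' e' * edge_diffusivity N G E' wp wm e e')"

definition effective_force :: "'a set \<Rightarrow> ('a \<Rightarrow> 'e \<Rightarrow> real) \<Rightarrow> ('a \<Rightarrow> real) \<Rightarrow> 'e \<Rightarrow> real" where
  "effective_force A d h e = (\<Sum>\<alpha>\<in>A. d \<alpha> e * h \<alpha>)"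

end

theory Submission
  imports Defs
begin

text \<open>
  Write \<open>p\<close> for the stationary vector at \<open>h\<^sup>\<star>\<close> and \<open>T\<^sub>e = w\<^sub>+\<^sub>e p(\<sigma>(e)) = w\<^sub>-\<^sub>e p(\<tau>(e))\<close>
  for a stalled edge. Differentiating the generator in the counting variable \<open>q\<^sub>e\<close> or in the force \<open>x\<^sub>e\<close> and
  applying it to \<open>p\<close> gives the same vector, \<open>T\<^sub>e\<close> times the difference of the indicators of \<open>\<tau>(e)\<close> and
  \<open>\<sigma>(e)\<close>: for the force this is local detailed balance. Hence the dominant eigenvector has the same
  first-order response \<open>p\<^sub>e\<close> to both. With the linear functional
  \<open>j\<^sub>e(x) = w\<^sub>+\<^sub>e x(\<sigma>(e)) - w\<^sub>-\<^sub>e x(\<tau>(e))\<close>, second-order perturbation theory of the eigenvalue yields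
  \<open>\<partial>\<^sub>e\<partial>\<^sub>f \<lambda> = 2 \<delta>\<^sub>e\<^sub>f T\<^sub>e + j\<^sub>e(p\<^sub>f) + j\<^sub>f(p\<^sub>e)\<close>, while the force derivative of the current \<open>J\<^sub>e = j\<^sub>e(p)\<close> is
  \<open>\<delta>\<^sub>e\<^sub>f T\<^sub>e + j\<^sub>e(p\<^sub>f)\<close>; symmetrizing the latter gives the former.
  Differentiability of the dominant eigenpair follows from exact difference identities, without an
  implicit function theorem.
\<close>

section \<open>Perron theory for irreducible Metzler matrices\<close>

text \<open>Irreducible Metzler matrices, the diagonal being free. Irreducibility is phrased through
  cuts (from every nonempty proper set of columns a positive entry leads to a row outside it),
  because a cut is what connectedness of a network supplies.\<close>

definition perron_matrix :: "nat \<Rightarrow> (nat \<Rightarrow> nat \<Rightarrow> real) \<Rightarrow> bool" where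
  "perron_matrix N W \<longleftrightarrow> 0 < N \<and> (\<forall>i<N. \<forall>j<N. i \<noteq> j \<longrightarrow> 0 \<le> W i j) \<and>
     (\<forall>S. S \<noteq> {} \<longrightarrow> S \<subset> {..<N} \<longrightarrow> (\<exists>j\<in>S. \<exists>i\<in>{..<N} - S. 0 < W i j))"

text \<open>Dominance of \<open>l\<close> is not demanded: for a \<open>perron_matrix\<close>,
  positivity of the eigenvector forces it. The normalization fixes the vector on
  \<open>{..<N}\<close>. Left eigenvectors are pairs of the transposed matrix.\<close>

definition perron_pair :: "nat \<Rightarrow> (nat \<Rightarrow> nat \<Rightarrow> real) \<Rightarrow> real \<Rightarrow> (nat \<Rightarrow> real) \<Rightarrow> bool" where
  "perron_pair N W l v \<longleftrightarrow>
     (\<forall>i<N. 0 < v i) \<and> (\<Sum>i<N. v i) = 1 \<and> (\<forall>i<N. (\<Sum>j<N. W i j * v j) = l * v i)"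

lemma perron_pairD:
  assumes "perron_pair N W l v"
  shows "i < N \<Longrightarrow> 0 < v i" "(\<Sum>i<N. v i) = 1" "i < N \<Longrightarrow> (\<Sum>j<N. W i j * v j) = l * v i"
  using assms by (auto simp: perron_pair_def)

text \<open>An entry leaving \<open>S\<close> in the transpose is an entry leaving the complement of
  \<open>S\<close> in \<open>W\<close>.\<close>

lemma perron_matrix_transpose:
  assumes "perron_matrix N W"
  shows "perron_matrix N (\<lambda>i j. W j i)"
proof -
  have "\<exists>j\<in>S. \<exists>i\<in>{..<N} - S. 0 < W j i" if S: "S \<noteq> {}" "S \<subset> {..<N}" for S
  proof -
    have "{..<N} - S \<noteq> {}" "{..<N} - S \<subset> {..<N}" using S by auto
    then obtain j i where "j \<in> {..<N} - S" "i \<in> {..<N} - ({..<N} - S)" "0 < W i j"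
      using assms unfolding perron_matrix_def by meson
    then show ?thesis using S by auto
  qed
  then show ?thesis using assms unfolding perron_matrix_def by auto
qed

text \<open>If \<open>y\<close> had a zero, some positive entry would lead from the support of
  \<open>y\<close> to an index \<open>m\<close> with \<open>y m = 0\<close>; row \<open>m\<close> of
  the eigenvalue equation would then equate a positive sum with zero.\<close>

lemma nonneg_eigenvector_pos:
  assumes W: "perron_matrix N W"
    and nn: "\<And>i. i < N \<Longrightarrow> 0 \<le> y i" and ev: "\<And>i. i < N \<Longrightarrow> (\<Sum>j<N. W i j * y j) = l * y i"
    and ex: "k < N" "y k \<noteq> 0" and i: "i < N"
  shows "0 < y i"
proof (rule ccontr)
  assume "\<not> 0 < y i"
  then have "y i = 0" using nn i by force
  define S where "S = {i. i < N \<and> y i \<noteq> 0}"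
  have "S \<noteq> {}" "S \<subset> {..<N}" using ex i \<open>y i = 0\<close> by (auto simp: S_def)
  then obtain j m where jm: "j \<in> S" "m \<in> {..<N} - S" "0 < W m j"
    using W unfolding perron_matrix_def by meson
  have m0: "m < N" "y m = 0" using jm by (auto simp: S_def)
  have "0 < W m j * y j" using jm nn[of j] by (auto simp: S_def)
  also have "\<dots> \<le> (\<Sum>j<N. W m j * y j)"
  proof (rule member_le_sum)
    show "j \<in> {..<N}" using jm by (auto simp: S_def)
    show "0 \<le> W m x * y x" if "x \<in> {..<N} - {j}" for x
      using W that nn[of x] m0 unfolding perron_matrix_def by (cases "x = m") auto
  qed auto
  also have "\<dots> = 0" using ev[OF m0(1)] m0 by simp
  finally show False by simp
qed

text \<open>Subtracting the largest multiple of \<open>v\<close> that keeps the difference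
  nonnegative leaves a solution of the eigenvalue equation with a zero entry, which must
  vanish.\<close>

lemma eigenvector_unique:
  assumes W: "perron_matrix N W"
    and v: "\<And>i. i < N \<Longrightarrow> 0 < v i" "\<And>i. i < N \<Longrightarrow> (\<Sum>j<N. W i j * v j) = l * v i"
    and x: "\<And>i. i < N \<Longrightarrow> (\<Sum>j<N. W i j * x j) = l * x i"
  shows "\<exists>k. \<forall>i<N. x i = k * v i"
proof -
  define k where "k = Min ((\<lambda>i. x i / v i) ` {..<N})"
  have N: "0 < N" using W by (simp add: perron_matrix_def)
  have "k \<in> (\<lambda>i. x i / v i) ` {..<N}" unfolding k_def using N by (intro Min_in) auto
  then obtain m where m: "m < N" "k = x m / v m" by auto
  define y where "y i = x i - k * v i" for i
  have ym: "y m = 0" using m v(1)[of m] by (simp add: y_def)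
  have nn: "0 \<le> y i" if "i < N" for i
  proof -
    have "k \<le> x i / v i" unfolding k_def using that by (intro Min_le) auto
    then show ?thesis using v(1)[OF that] by (simp add: y_def field_simps)
  qed
  have ev: "(\<Sum>j<N. W i j * y j) = l * y i" if "i < N" for i
  proof -
    have "(\<Sum>j<N. W i j * y j) = (\<Sum>j<N. W i j * x j) - k * (\<Sum>j<N. W i j * v j)"
      by (simp add: y_def sum_subtractf sum_distrib_left algebra_simps)
    then show ?thesis using v(2)[OF that] x[OF that] by (simp add: y_def algebra_simps)
  qed
  have "y i = 0" if "i < N" for i
    using nonneg_eigenvector_pos[OF W nn ev that _ m(1)] ym by fastforce
  then show ?thesis by (auto simp: y_def)
qed

lemma perron_pair_vector_unique:
  assumes "perron_matrix N W" "perron_pair N W l v" "perron_pair N W l x" "i < N"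
  shows "x i = v i"
proof -
  note v = perron_pairD[OF assms(2)] and x = perron_pairD[OF assms(3)]
  obtain k where k: "\<forall>i<N. x i = k * v i"
    using eigenvector_unique[OF assms(1) v(1,3) x(3)] by blast
  have "(\<Sum>i<N. x i) = k * (\<Sum>i<N. v i)" using k by (simp add: sum_distrib_left)
  then show ?thesis using x(2) v(2) k assms(4) by simp
qed

section \<open>Pairing of left and right eigenvectors\<close>

lemma left_right_pairing:
  fixes W :: "nat \<Rightarrow> nat \<Rightarrow> real"
  shows "(\<Sum>i<N. u i * (\<Sum>j<N. W i j * x j)) = (\<Sum>j<N. (\<Sum>i<N. W i j * u i) * x j)"
  by (simp add: sum_distrib_left sum_distrib_right mult_ac) (rule sum.swap)

lemma left_eigenvector_pairing:
  fixes W :: "nat \<Rightarrow> nat \<Rightarrow> real"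
  assumes "\<And>j. j < N \<Longrightarrow> (\<Sum>i<N. W i j * u i) = l * u j"
  shows "(\<Sum>i<N. u i * (\<Sum>j<N. W i j * x j)) = l * (\<Sum>i<N. u i * x i)"
  unfolding left_right_pairing using assms by (simp add: sum_distrib_left mult_ac)

lemma perron_pair_pairing_pos:
  assumes "perron_pair N W l v" "0 < N" "\<And>i. i < N \<Longrightarrow> 0 < u i"
  shows "0 < (\<Sum>i<N. u i * v i)"
  using assms by (intro sum_pos) (auto simp: perron_pair_def)

text \<open>Evaluating \<open>u W v\<close> through either eigenvalue equation gives
  \<open>l\<close> and \<open>k\<close> times the same positive pairing.\<close>

lemma perron_pair_left_right_root:
  assumes "0 < N" and v: "perron_pair N W l v" and u: "perron_pair N (\<lambda>i j. W j i) k u"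
  shows "k = l"
proof -
  have "(\<Sum>i<N. u i * (l * v i)) = k * (\<Sum>i<N. u i * v i)"
    using left_eigenvector_pairing[of N W u k v] perron_pairD(3)[OF u] perron_pairD(3)[OF v] by simp
  then have "l * (\<Sum>i<N. u i * v i) = k * (\<Sum>i<N. u i * v i)"
    by (simp add: sum_distrib_left mult_ac)
  moreover have "0 < (\<Sum>i<N. u i * v i)"
    using perron_pair_pairing_pos[OF v assms(1)] perron_pairD(1)[OF u] by blast
  ultimately show ?thesis by simp
qed

text \<open>Collatz--Wielandt: the largest \<open>r\<close> with \<open>r x \<le> A x\<close> for some \<open>x\<close> in the simplex is an
  eigenvalue, because otherwise a power of \<open>A\<close> turns the slack \<open>A x - r x\<close> strictly positive.\<close>

lemma irreducible_power_pos:
  fixes N :: nat and A :: "nat \<Rightarrow> nat \<Rightarrow> real"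
  defines "T \<equiv> \<lambda>f i. if i < N then (\<Sum>j<N. A i j * f j) else 0"
  assumes A: "perron_matrix N A" "\<And>i. i < N \<Longrightarrow> 0 < A i i"
    and f: "\<And>i. i < N \<Longrightarrow> 0 \<le> f i" "m < N" "0 < f m"
  shows "\<exists>k. \<forall>i<N. 0 < (T ^^ k) f i"
  using f
\<comment> \<open>Induction on the number of zeros: the positive diagonal preserves the support
  under \<open>T\<close>, and irreducibility enlarges it as long as a zero remains.\<close>
proof (induction "card {i. i < N \<and> f i = 0}" arbitrary: f m rule: less_induct)
  case less
  have A0: "0 \<le> A i j" if "i < N" "j < N" for i j
    using A that by (cases "i = j") (auto simp: perron_matrix_def less_imp_le)
  have T_nn: "0 \<le> T f i" if "i < N" for i
    using that A0 less.prems by (auto simp: T_def intro!: sum_nonneg)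
  have T_ge: "A i j * f j \<le> T f i" if "i < N" "j < N" for i j
  proof -
    have "A i j * f j \<le> (\<Sum>j<N. A i j * f j)"
      by (rule member_le_sum) (use that A0 less.prems in auto)
    then show ?thesis using that by (simp add: T_def)
  qed
  have T_pos: "0 < T f i" if "i < N" "j < N" "0 < A i j" "0 < f j" for i j
    using T_ge[of i j] that by (meson less_le_trans mult_pos_pos)
  show ?case
  proof (cases "\<forall>i<N. 0 < f i")
    case True
    then show ?thesis by (intro exI[of _ 0]) simp
  next
    case False
    define S where "S = {i. i < N \<and> 0 < f i}"
    have "S \<noteq> {}" "S \<subset> {..<N}" using less.prems False by (auto simp: S_def)
    then obtain j i where ji: "j \<in> S" "i \<in> {..<N} - S" "0 < A i j"
      using A(1) unfolding perron_matrix_def by meson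
    have "i < N" "f i = 0" using ji less.prems(1)[of i] by (auto simp: S_def)
    moreover have "T f i \<noteq> 0" using T_pos[of i j] ji by (auto simp: S_def)
    moreover have "{i. i < N \<and> T f i = 0} \<subseteq> {i. i < N \<and> f i = 0}"
      using T_pos A(2) less.prems(1) by (auto simp: order_less_le)
    ultimately have "card {i. i < N \<and> T f i = 0} < card {i. i < N \<and> f i = 0}"
      by (intro psubset_card_mono) auto
    from less.hyps[OF this T_nn less.prems(2) T_pos] A(2) less.prems
    obtain k where "\<forall>i<N. 0 < (T ^^ k) (T f) i" by blast
    then show ?thesis by (intro exI[of _ "Suc k"]) (simp only: funpow_Suc_right o_def)
  qed
qed

lemma perron_pair_exists_nonneg:
  assumes A: "perron_matrix N A" and diag: "\<And>i. i < N \<Longrightarrow> 0 < A i i"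
  shows "\<exists>r v. perron_pair N A r v"
proof -
  have N: "0 < N" using A by (simp add: perron_matrix_def)
  have A0: "0 \<le> A i j" if "i < N" "j < N" for i j
    using A diag that by (cases "i = j") (auto simp: perron_matrix_def less_imp_le)
  define T where "T f i = (if i < N then (\<Sum>j<N. A i j * f j) else 0)" for f i
  \<comment> \<open>Summing \<open>r x \<le> A x\<close> over the simplex bounds every admissible
    \<open>r\<close> by \<open>R\<close>, so the largest \<open>r\<close> can be sought in a compact
    set.\<close>
  define R where "R = (\<Sum>i<N. \<Sum>j<N. A i j)"
  \<comment> \<open>Coordinates from \<open>N\<close> on are pinned to \<open>0\<close>, so that a
    product of compact sets over all of \<open>nat\<close> models a box around the simplex.\<close>
  define K where "K = PiE UNIV (\<lambda>i. if i < N then {0..1::real} else {0})"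
  define C where "C = {xr :: (nat \<Rightarrow> real) \<times> real. (\<Sum>i<N. fst xr i) = 1 \<and>
     (\<forall>i<N. snd xr * fst xr i \<le> (\<Sum>j<N. A i j * fst xr j))}"
  have T_sub: "snd xr * fst xr i \<le> T (fst xr) i" if "xr \<in> C" "i < N" for xr i
    using that by (auto simp: C_def T_def)
  have cK: "compact K"
    using compactin_PiE[of "\<lambda>_. euclidean" UNIV "\<lambda>i. if i < N then {0..1::real} else {0}"]
    unfolding K_def by (simp add: euclidean_product_topology)
  have coord: "continuous_on UNIV (\<lambda>xr :: (nat \<Rightarrow> real) \<times> real. fst xr i)" for i
    by (rule continuous_on_product_then_coordinatewise) (intro continuous_intros)
  have "closed C"
    unfolding C_def
    by (intro closed_Collect_conj closed_Collect_all closed_Collect_imp open_Collect_const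
        closed_Collect_eq closed_Collect_le continuous_intros coord)
  then have "compact ((K \<times> {0..R}) \<inter> C)"
    by (intro compact_Int_closed compact_Times cK) auto
  moreover
  define x0 :: "nat \<Rightarrow> real" where "x0 i = (if i = 0 then 1 else 0)" for i
  have "(x0, 0) \<in> (K \<times> {0..R}) \<inter> C"
    using N A0 by (auto simp: K_def C_def x0_def R_def intro!: sum_nonneg)
  ultimately obtain xr where xr: "xr \<in> (K \<times> {0..R}) \<inter> C"
    and max: "\<And>yr. yr \<in> (K \<times> {0..R}) \<inter> C \<Longrightarrow> snd yr \<le> snd xr"
    using continuous_attains_sup[of "(K \<times> {0..R}) \<inter> C" snd] continuous_on_snd[OF continuous_on_id]
    by blast
  define x r where "x = fst xr" and "r = snd xr"
  have x_K: "x \<in> K" and r0: "0 \<le> r" and x1: "(\<Sum>i<N. x i) = 1"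
    using xr by (auto simp: x_def r_def C_def mem_Times_iff)
  have x0: "0 \<le> x i" if "i < N" for i
    using x_K that unfolding K_def by (auto dest!: PiE_mem[of _ _ _ i])
  have xout: "x i = 0" if "\<not> i < N" for i
    using x_K that unfolding K_def by (auto dest!: PiE_mem[of _ _ _ i])
  define z where "z i = T x i - r * x i" for i
  have z0: "0 \<le> z i" if "i < N" for i
    using T_sub[of xr i] xr that by (simp add: z_def x_def r_def)
  have "z i = 0" if "i < N" for i
  proof (rule ccontr)
    assume "z i \<noteq> 0"
    then have "0 < z i" using z0[OF that] by simp
    then obtain k where k: "\<forall>i<N. 0 < (T ^^ k) z i"
      using irreducible_power_pos[of N A z i] A diag z0 \<open>i < N\<close> unfolding T_def by blast
    \<comment> \<open>Passing from \<open>x\<close> to \<open>y\<close> turns the slack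
      \<open>z\<close> into \<open>(T ^^ k) z\<close>, which is positive everywhere and leaves room
      for a larger \<open>r\<close>.\<close>
    define y where "y = (T ^^ k) x"
    have T_nn: "(\<And>i. i < N \<Longrightarrow> 0 \<le> f i) \<Longrightarrow> (\<And>i. i < N \<Longrightarrow> 0 \<le> (T ^^ n) f i)" for f n
      by (induction n) (auto simp: T_def A0 intro!: sum_nonneg)
    have y0: "0 \<le> y i" if "i < N" for i
      unfolding y_def using T_nn x0 that by blast
    have yout: "y i = 0" if "\<not> i < N" for i
      unfolding y_def using xout that by (cases k) (auto simp: T_def)
    have T_lin: "T (\<lambda>i. f i - r * g i) = (\<lambda>i. T f i - r * T g i)" for f g
      by (auto simp: T_def fun_eq_iff sum_subtractf sum_distrib_left algebra_simps)
    have "(T ^^ n) z = (\<lambda>i. T ((T ^^ n) x) i - r * (T ^^ n) x i)" for n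
    proof (induction n)
      case (Suc n)
      show ?case
        by (simp add: Suc T_lin)
    qed (simp add: z_def fun_eq_iff)
    then have Ty: "T y i = r * y i + (T ^^ k) z i" for i by (simp add: y_def)
    define s where "s = (\<Sum>i<N. y i)"
    have "s \<noteq> 0"
    proof
      assume "s = 0"
      then have "y j = 0" if "j < N" for j
        using sum_nonneg_0[of "{..<N}" y j] y0 that by (simp add: s_def)
      then have "T y i = 0" by (simp add: T_def)
      then show False using Ty[of i] k[rule_format, of i] \<open>i < N\<close> \<open>\<And>j. j < N \<Longrightarrow> y j = 0\<close> by simp
    qed
    moreover have "0 \<le> s" unfolding s_def using y0 by (intro sum_nonneg) auto
    ultimately have s: "0 < s" by simp
    \<comment> \<open>The smallest slack of \<open>y\<close> over its mass: as
      \<open>y' i \<le> 1\<close>, the product \<open>\<epsilon> * y i\<close> does not exceed that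
      slack.\<close>
    define \<epsilon> where "\<epsilon> = Min ((T ^^ k) z ` {..<N}) / s"
    have "0 < Min ((T ^^ k) z ` {..<N})" using N k by (subst Min_gr_iff) auto
    then have \<epsilon>: "0 < \<epsilon>" using s by (simp add: \<epsilon>_def)
    define y' where "y' i = y i / s" for i
    have y'0: "0 \<le> y' i" if "i < N" for i using y0 s that by (simp add: y'_def)
    have y'1: "(\<Sum>i<N. y' i) = 1" using s by (simp add: y'_def s_def sum_divide_distrib[symmetric])
    have y'_le: "y' i \<le> 1" if "i < N" for i
      using member_le_sum[of i "{..<N}" y'] y'0 y'1 that by simp
    have sub: "(r + \<epsilon>) * y' i \<le> (\<Sum>j<N. A i j * y' j)" if "i < N" for i
    proof -
      have "\<epsilon> * y i = Min ((T ^^ k) z ` {..<N}) * y' i" by (simp add: \<epsilon>_def y'_def)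
      also have "\<dots> \<le> Min ((T ^^ k) z ` {..<N}) * 1"
        using \<open>0 < Min _\<close> y'_le[OF that] by (intro mult_left_mono) auto
      also have "\<dots> \<le> (T ^^ k) z i" using that by (auto intro!: Min_le)
      finally have "(r + \<epsilon>) * y i \<le> T y i" by (simp add: Ty algebra_simps)
      then have "(r + \<epsilon>) * y i / s \<le> T y i / s" using s by (intro divide_right_mono) auto
      then show ?thesis using that by (simp add: T_def y'_def sum_divide_distrib)
    qed
    have "r + \<epsilon> = (\<Sum>i<N. (r + \<epsilon>) * y' i)" using y'1 by (simp add: sum_distrib_left[symmetric])
    also have "\<dots> \<le> (\<Sum>i<N. \<Sum>j<N. A i j * y' j)" using sub by (intro sum_mono) auto
    also have "\<dots> \<le> R" unfolding R_def
      using A0 y'0 y'_le by (intro sum_mono mult_left_le) auto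
    finally have "r + \<epsilon> \<le> R" .
    then have "(y', r + \<epsilon>) \<in> (K \<times> {0..R}) \<inter> C"
      using sub y'0 y'_le y'1 yout r0 \<epsilon> by (auto simp: K_def C_def y'_def)
    from max[OF this] \<epsilon> show False by (simp add: r_def)
  qed
  then have ev: "(\<Sum>j<N. A i j * x j) = r * x i" if "i < N" for i
    using that by (auto simp: z_def T_def)
  have "\<exists>m<N. x m \<noteq> 0" using x1 by (metis lessThan_iff sum.neutral zero_neq_one)
  then have "0 < x i" if "i < N" for i
    using nonneg_eigenvector_pos[OF A x0 ev _ _ that] by blast
  then show ?thesis using ev x1 by (auto simp: perron_pair_def)
qed

text \<open>Adding \<open>c\<close> times the identity shifts the root by \<open>c\<close>, keeps
  the eigenvectors, and for this \<open>c\<close> makes the diagonal positive.\<close>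

lemma perron_pair_exists:
  assumes W: "perron_matrix N W"
  shows "\<exists>l v. perron_pair N W l v"
proof -
  define c where "c = 1 + (\<Sum>i<N. \<bar>W i i\<bar>)"
  define A where "A i j = W i j + c * of_bool (i = j)" for i j
  have "0 < A i i" if "i < N" for i
  proof -
    have "\<bar>W i i\<bar> \<le> (\<Sum>i<N. \<bar>W i i\<bar>)" using that by (intro member_le_sum) auto
    then show ?thesis by (simp add: A_def c_def)
  qed
  moreover have "perron_matrix N A"
  proof -
    have "\<exists>j\<in>S. \<exists>i\<in>{..<N} - S. 0 < A i j" if S: "S \<noteq> {}" "S \<subset> {..<N}" for S
    proof -
      obtain j i where "j \<in> S" "i \<in> {..<N} - S" "0 < W i j"
        using W S unfolding perron_matrix_def by meson
      then have "j \<in> S" "i \<in> {..<N} - S" "0 < A i j" by (auto simp: A_def)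
      then show ?thesis by blast
    qed
    then show ?thesis using W by (auto simp: perron_matrix_def A_def)
  qed
  ultimately obtain r v where rv: "perron_pair N A r v"
    using perron_pair_exists_nonneg by blast
  have "(\<Sum>j<N. W i j * v j) = (r - c) * v i" if "i < N" for i
  proof -
    have "A i j * v j = W i j * v j + (if i = j then c * v j else 0)" for j
      by (simp add: A_def algebra_simps)
    then have "(\<Sum>j<N. A i j * v j) = (\<Sum>j<N. W i j * v j) + c * v i"
      using that by (simp add: sum.distrib)
    then show ?thesis using perron_pairD(3)[OF rv that] that by (simp add: algebra_simps)
  qed
  then have "perron_pair N W (r - c) v" using rv by (auto simp: perron_pair_def)
  then show ?thesis by blast
qed

section \<open>Spectrum of the matrix: dominance and algebraic simplicity of the Perron root\<close>

lemma mat_mult_vec_sum: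
  "mat N N (\<lambda>(i, j). W i j) *\<^sub>v vec N x = vec N (\<lambda>i. \<Sum>j<N. W i j * x j)"
  by (rule eq_vecI) (auto simp: scalar_prod_def atLeast0LessThan)

lemma exists_nonzero_vec_iff:
  "(\<exists>v. v \<in> carrier_vec N \<and> v \<noteq> 0\<^sub>v N \<and> P v) \<longleftrightarrow> (\<exists>x. (\<exists>i<N. x i \<noteq> 0) \<and> P (vec N x))"
proof safe
  fix v assume v: "v \<in> carrier_vec N" "v \<noteq> 0\<^sub>v N" "P v"
  then have "v = vec N (vec_index v)" "\<exists>i<N. vec_index v i \<noteq> 0" by (auto intro!: eq_vecI)
  then show "\<exists>x. (\<exists>i<N. x i \<noteq> 0) \<and> P (vec N x)" using v(3) by metis
next
  fix x i assume x: "P (vec N x)" "i < N" "x i \<noteq> 0"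
  then have "vec_index (vec N x) i \<noteq> vec_index (0\<^sub>v N) i" by simp
  then have "vec N x \<noteq> 0\<^sub>v N" by metis
  then show "\<exists>v. v \<in> carrier_vec N \<and> v \<noteq> 0\<^sub>v N \<and> P v" using x(1) vec_carrier by blast
qed

lemma eigenvalue_mat_iff:
  "eigenvalue (mat N N (\<lambda>(i, j). W i j)) z \<longleftrightarrow>
     (\<exists>x. (\<exists>i<N. x i \<noteq> 0) \<and> (\<forall>i<N. (\<Sum>j<N. W i j * x j) = z * x i))"
proof -
  have "mat N N (\<lambda>(i, j). W i j) *\<^sub>v vec N x = z \<cdot>\<^sub>v vec N x \<longleftrightarrow>
      (\<forall>i<N. (\<Sum>j<N. W i j * x j) = z * x i)" for x
    unfolding mat_mult_vec_sum by (auto simp: vec_eq_iff)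
  then show ?thesis
    by (simp add: eigenvalue_def eigenvector_def exists_nonzero_vec_iff)
qed

lemma det_mat_eq_0_iff:
  fixes M :: "nat \<Rightarrow> nat \<Rightarrow> 'a::field"
  shows "Determinant.det (mat N N (\<lambda>(i, j). M i j)) = 0 \<longleftrightarrow>
     (\<exists>x. (\<exists>i<N. x i \<noteq> 0) \<and> (\<forall>i<N. (\<Sum>j<N. M i j * x j) = 0))"
proof -
  have "mat N N (\<lambda>(i, j). M i j) *\<^sub>v vec N x = 0\<^sub>v N \<longleftrightarrow> (\<forall>i<N. (\<Sum>j<N. M i j * x j) = 0)" for x
    unfolding mat_mult_vec_sum by (auto simp: vec_eq_iff)
  then show ?thesis
    by (subst det_0_iff_vec_prod_zero_field[of _ N]) (auto simp: exists_nonzero_vec_iff)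
qed

text \<open>The moduli of \<open>x\<close> satisfy the eigenvalue equation as an inequality with
  \<open>Re z\<close>; the diagonal is split off first because it may be negative. Pairing with the
  positive left eigenvector compares \<open>Re z\<close> with \<open>l\<close>.\<close>

lemma perron_root_dominates:
  fixes z :: complex
  assumes W: "perron_matrix N W"
    and u: "\<And>i. i < N \<Longrightarrow> 0 < u i" "\<And>j. j < N \<Longrightarrow> (\<Sum>i<N. W i j * u i) = l * u j"
    and x: "m < N" "x m \<noteq> 0" "\<And>i. i < N \<Longrightarrow> (\<Sum>j<N. complex_of_real (W i j) * x j) = z * x i"
  shows "Re z \<le> l"
proof -
  have le: "Re z * cmod (x i) \<le> (\<Sum>j<N. W i j * cmod (x j))" if i: "i < N" for i
  proof -
    have "(z - of_real (W i i)) * x i = (\<Sum>j\<in>{..<N} - {i}. complex_of_real (W i j) * x j)"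
      using x(3)[OF i] i by (simp add: sum.remove[of _ i] algebra_simps)
    then have "cmod (z - of_real (W i i)) * cmod (x i)
        = cmod (\<Sum>j\<in>{..<N} - {i}. complex_of_real (W i j) * x j)"
      by (metis norm_mult)
    also have "\<dots> \<le> (\<Sum>j\<in>{..<N} - {i}. cmod (complex_of_real (W i j) * x j))"
      by (rule norm_sum)
    also have "\<dots> = (\<Sum>j\<in>{..<N} - {i}. W i j * cmod (x j))"
      using W i by (intro sum.cong) (auto simp: norm_mult perron_matrix_def)
    finally have "cmod (z - of_real (W i i)) * cmod (x i) \<le> (\<Sum>j\<in>{..<N} - {i}. W i j * cmod (x j))" .
    moreover have "(Re z - W i i) * cmod (x i) \<le> cmod (z - of_real (W i i)) * cmod (x i)"
      using complex_Re_le_cmod[of "z - of_real (W i i)"] by (intro mult_right_mono) auto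
    ultimately have "Re z * cmod (x i) \<le> W i i * cmod (x i) + (\<Sum>j\<in>{..<N} - {i}. W i j * cmod (x j))"
      by (simp add: algebra_simps)
    then show ?thesis using i by (simp add: sum.remove[of _ i])
  qed
  define s where "s = (\<Sum>i<N. u i * cmod (x i))"
  have "0 < u m * cmod (x m)" using u x by simp
  also have "\<dots> \<le> s" unfolding s_def
    by (rule member_le_sum) (use u x in \<open>auto simp: less_imp_le\<close>)
  finally have "0 < s" .
  have "Re z * s = (\<Sum>i<N. u i * (Re z * cmod (x i)))" by (simp add: s_def sum_distrib_left mult_ac)
  also have "\<dots> \<le> (\<Sum>i<N. u i * (\<Sum>j<N. W i j * cmod (x j)))"
    using le u by (intro sum_mono mult_left_mono) (auto simp: less_imp_le)
  also have "\<dots> = l * s" unfolding s_def by (rule left_eigenvector_pairing) (rule u)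
  finally show ?thesis using \<open>0 < s\<close> by simp
qed

text \<open>Replacing row \<open>0\<close> of \<open>x I - W\<close> by its combination with the left eigenvector \<open>u\<close> splits off
  one factor \<open>x - l\<close>; the remaining determinant does not vanish at \<open>l\<close>, because a vector in its kernel
  is an eigenvector orthogonal to \<open>u\<close>.\<close>

lemma perron_root_simple:
  assumes W: "perron_matrix N W"
    and v: "\<And>i. i < N \<Longrightarrow> 0 < v i" "\<And>i. i < N \<Longrightarrow> (\<Sum>j<N. W i j * v j) = l * v i"
    and u: "\<And>i. i < N \<Longrightarrow> 0 < u i" "\<And>j. j < N \<Longrightarrow> (\<Sum>i<N. W i j * u i) = l * u j"
  shows "Polynomial.order l (char_poly (mat N N (\<lambda>(i, j). W i j))) = 1"
proof -
  have N: "0 < N" using W by (simp add: perron_matrix_def)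
  define X where "X i j = (if i = j then [:- W i j, 1:] else [:- W i j:])" for i j
  have cpm: "char_poly_matrix (mat N N (\<lambda>(i, j). W i j)) = mat N N (\<lambda>(i, j). X i j)"
    by (rule eq_matI) (auto simp: char_poly_matrix_def X_def)
  \<comment> \<open>The identity with row \<open>0\<close> replaced by \<open>u\<close>:
    multiplication by it from the left performs the row replacement and costs the determinant
    \<open>u 0\<close>.\<close>
  define L where "L = mat N N (\<lambda>(i, j). if i = 0 then [:u j:] else if i = j then 1 else 0)"
  define M where "M = mat N N (\<lambda>(i, j). if i = 0 then [:u j:] else X i j)"
  have row0: "(\<Sum>k<N. [:u k:] * X k j) = [:-l, 1:] * [:u j:]" if j: "j < N" for j
  proof -
    have "[:u k:] * X k j = [:- (W k j * u k):] + (if k = j then [:0, u j:] else 0)" for k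
      by (auto simp: X_def)
    then have "(\<Sum>k<N. [:u k:] * X k j) = (\<Sum>k<N. [:- (W k j * u k):]) + [:0, u j:]"
      using j by (simp add: sum.distrib)
    also have "(\<Sum>k<N. [:- (W k j * u k):]) = [:- (\<Sum>k<N. W k j * u k):]"
      by (induction N) auto
    finally show ?thesis using u(2)[OF j] by simp
  qed
  have L: "L * mat N N (\<lambda>(i, j). X i j) = multrow 0 [:-l, 1:] M"
  proof (rule eq_matI)
    fix i j assume "i < dim_row (multrow 0 [:-l, 1:] M)" "j < dim_col (multrow 0 [:-l, 1:] M)"
    then have ij: "i < N" "j < N" by (auto simp: M_def)
    have "(L * mat N N (\<lambda>(i, j). X i j)) $$ (i, j)
        = (\<Sum>k<N. (if i = 0 then [:u k:] else if i = k then 1 else 0) * X k j)"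
      using ij by (simp add: L_def scalar_prod_def atLeast0LessThan)
    also have "\<dots> = (if i = 0 then [:-l, 1:] * [:u j:] else X i j)"
    proof (cases "i = 0")
      case True
      then show ?thesis using row0[OF ij(2)] by simp
    next
      case False
      have "(\<Sum>k<N. (if i = k then 1 else 0) * X k j) = (\<Sum>k<N. if i = k then X k j else 0)"
        by (rule sum.cong) auto
      then show ?thesis using False ij by simp
    qed
    finally show "(L * mat N N (\<lambda>(i, j). X i j)) $$ (i, j) = multrow 0 [:-l, 1:] M $$ (i, j)"
      using ij by (auto simp: M_def)
  qed (auto simp: L_def M_def)
  have "Determinant.det L = prod_list (diag_mat L)"
    by (rule det_upper_triangular[of _ N]) (auto simp: L_def upper_triangular_def)
  also have "\<dots> = (\<Prod>i<N. L $$ (i, i))"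
    by (simp add: prod_list_diag_prod L_def atLeast0LessThan)
  also have "\<dots> = (\<Prod>i<N. if i = 0 then [:u 0:] else 1)"
    by (rule prod.cong) (auto simp: L_def)
  also have "\<dots> = [:u 0:]" using N by (simp add: prod.delta)
  finally have "[:u 0:] * char_poly (mat N N (\<lambda>(i, j). W i j))
      = Determinant.det (L * mat N N (\<lambda>(i, j). X i j))"
    by (subst det_mult[of _ N]) (auto simp: char_poly_def cpm L_def)
  also have "\<dots> = [:-l, 1:] * Determinant.det M"
    unfolding L using N by (subst det_multrow[of _ N]) (auto simp: M_def)
  finally have fact: "[:u 0:] * char_poly (mat N N (\<lambda>(i, j). W i j)) = [:-l, 1:] * Determinant.det M" .
  define M1 where "M1 i j = (if i = 0 then u j else poly (X i j) l)" for i j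
  have "Determinant.det (mat N N (\<lambda>(i, j). M1 i j)) \<noteq> 0"
  proof
    assume "Determinant.det (mat N N (\<lambda>(i, j). M1 i j)) = 0"
    then obtain x where x: "\<exists>i<N. x i \<noteq> 0" and M0: "\<And>i. i < N \<Longrightarrow> (\<Sum>j<N. M1 i j * x j) = 0"
      unfolding det_mat_eq_0_iff by blast
    have ux: "(\<Sum>j<N. u j * x j) = 0" using M0[OF N] by (simp add: M1_def)
    have row: "(\<Sum>j<N. W i j * x j) = l * x i" if i: "i < N" "i \<noteq> 0" for i
    proof -
      have "M1 i j * x j = (if i = j then l * x j else 0) - W i j * x j" for j
        using i by (simp add: M1_def X_def algebra_simps)
      then show ?thesis using M0[OF i(1)] i by (simp add: sum_subtractf)
    qed
    \<comment> \<open>The residuals of the eigenvalue equation pair to zero with \<open>u\<close>,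
      and those of the rows other than \<open>0\<close> vanish; as \<open>u 0\<close> is positive,
      row \<open>0\<close> holds as well.\<close>
    have "(\<Sum>i<N. u i * (\<Sum>j<N. W i j * x j)) = 0"
      using left_eigenvector_pairing[of N W u l x, OF u(2)] ux by simp
    moreover have "(\<Sum>i<N. u i * (l * x i)) = 0"
      using arg_cong[OF ux, of "(*) l"] by (simp add: sum_distrib_left mult_ac)
    ultimately have "(\<Sum>i<N. u i * ((\<Sum>j<N. W i j * x j) - l * x i)) = 0"
      by (simp add: right_diff_distrib sum_subtractf)
    moreover have "(\<Sum>i<N. u i * ((\<Sum>j<N. W i j * x j) - l * x i))
        = (\<Sum>i<N. if i = 0 then u 0 * ((\<Sum>j<N. W 0 j * x j) - l * x 0) else 0)"
      using row by (intro sum.cong) auto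
    ultimately have "(\<Sum>j<N. W 0 j * x j) = l * x 0" using N u(1)[OF N] by simp
    then have "(\<Sum>j<N. W i j * x j) = l * x i" if "i < N" for i
      using row that by (cases "i = 0") auto
    then obtain k where k: "\<forall>i<N. x i = k * v i"
      using eigenvector_unique[OF W v] by blast
    then have "k * (\<Sum>j<N. u j * v j) = 0"
      using ux by (simp add: sum_distrib_left mult_ac)
    moreover have "0 < (\<Sum>j<N. u j * v j)" using N u v by (intro sum_pos) auto
    ultimately show False using k x by auto
  qed
  moreover have "poly (Determinant.det M) l = Determinant.det (mat N N (\<lambda>(i, j). M1 i j))"
    by (rule poly_det_cong[of _ N]) (auto simp: M_def M1_def)
  ultimately have M: "poly (Determinant.det M) l \<noteq> 0" by simp
  then have "Determinant.det M \<noteq> 0" by auto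
  then have nz: "[:-l, 1:] * Determinant.det M \<noteq> 0" by (simp only: mult_eq_0_iff) simp
  have "Polynomial.order l ([:u 0:] * char_poly (mat N N (\<lambda>(i, j). W i j)))
      = Polynomial.order l ([:-l, 1:] * Determinant.det M)"
    by (simp only: fact)
  moreover have "Polynomial.order l ([:-l, 1:] * Determinant.det M) = 1"
    using order_mult[OF nz, of l] order_power_n_n[of l 1] M by (simp add: order_0I)
  moreover have "Polynomial.order l ([:u 0:] * char_poly (mat N N (\<lambda>(i, j). W i j)))
      = Polynomial.order l (char_poly (mat N N (\<lambda>(i, j). W i j)))"
    using u(1)[OF N] by (simp add: order_smult)
  ultimately show ?thesis by simp
qed

lemma is_dominant_eigenvalue_unique:
  assumes "W \<in> carrier_mat N N" "is_dominant_eigenvalue W l" "is_dominant_eigenvalue W k"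
  shows "l = k"
proof -
  have "eigenvalue (map_mat complex_of_real W) (complex_of_real r)" if "eigenvalue W r" for r
    using of_real_hom.eigenvalue_hom[OF assms(1) that] .
  then show ?thesis using assms unfolding is_dominant_eigenvalue_def
    by (metis Re_complex_of_real order_antisym)
qed

text \<open>The transpose supplies a positive left eigenvector for the same root, from which
  dominance and simplicity follow. Afterwards the definite description can be replaced by any root
  with a positive eigenvector.\<close>

lemma dominant_eigenvalue_perron:
  assumes W: "perron_matrix N W" and v: "perron_pair N W l v"
  shows "dominant_eigenvalue (mat N N (\<lambda>(i, j). W i j)) = l"
proof -
  have N: "0 < N" using W by (simp add: perron_matrix_def)
  obtain k u where u: "perron_pair N (\<lambda>i j. W j i) k u"
    using perron_pair_exists[OF perron_matrix_transpose[OF W]] by blast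
  have "k = l" using perron_pair_left_right_root[OF N v u] .
  note u = perron_pairD[OF u[unfolded \<open>k = l\<close>]] and v = perron_pairD[OF v]
  have "\<exists>i<N. v i \<noteq> 0" using v(1)[OF N] N by (intro exI[of _ 0]) auto
  then have "eigenvalue (mat N N (\<lambda>(i, j). W i j)) l"
    unfolding eigenvalue_mat_iff using v by blast
  moreover have "Re z \<le> l" if z: "eigenvalue (map_mat complex_of_real (mat N N (\<lambda>(i, j). W i j))) z" for z
  proof -
    have eq: "map_mat complex_of_real (mat N N (\<lambda>(i, j). W i j)) = mat N N (\<lambda>(i, j). complex_of_real (W i j))"
      by (rule eq_matI) auto
    obtain x m where "m < N" "x m \<noteq> 0"
      "\<And>i. i < N \<Longrightarrow> (\<Sum>j<N. complex_of_real (W i j) * x j) = z * x i"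
      using z[unfolded eq] unfolding eigenvalue_mat_iff by auto
    then show ?thesis using perron_root_dominates[of N W u l m x z] W u by blast
  qed
  ultimately have dom: "is_dominant_eigenvalue (mat N N (\<lambda>(i, j). W i j)) l"
    using perron_root_simple[OF W v(1,3) u(1,3)] by (auto simp: is_dominant_eigenvalue_def)
  have "r = l" if "is_dominant_eigenvalue (mat N N (\<lambda>(i, j). W i j)) r" for r
    by (rule is_dominant_eigenvalue_unique[OF mat_carrier that dom])
  then show ?thesis
    unfolding dominant_eigenvalue_def using dom by (intro the_equality)
qed

lemma left_inverse_exists:
  fixes M :: "nat \<Rightarrow> nat \<Rightarrow> 'a::field"
  assumes inj: "\<forall>x. (\<forall>i<N. (\<Sum>j<N. M i j * x j) = 0) \<longrightarrow> (\<forall>i<N. x i = 0)"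
  obtains B where "\<And>x i. i < N \<Longrightarrow> (\<Sum>j<N. B i j * (\<Sum>k<N. M j k * x k)) = x i"
proof -
  let ?M = "mat N N (\<lambda>(i, j). M i j)"
  have "Determinant.det ?M \<noteq> 0" unfolding det_mat_eq_0_iff using inj by blast
  then have "?M \<in> Units (ring_mat TYPE('a) N ())" by (intro det_non_zero_imp_unit) auto
  then obtain C where C: "C \<in> carrier_mat N N" "C * ?M = 1\<^sub>m N"
    by (auto simp: Units_def ring_mat_simps)
  have "(\<Sum>j<N. C $$ (i, j) * (\<Sum>k<N. M j k * x k)) = x i" if i: "i < N" for x i
  proof -
    have Ceq: "C = mat N N (\<lambda>(i, j). C $$ (i, j))" using C by (intro eq_matI) auto
    have "vec N x = (C * ?M) *\<^sub>v vec N x" by (simp add: C)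
    also have "\<dots> = C *\<^sub>v (?M *\<^sub>v vec N x)" using C by (intro assoc_mult_mat_vec) auto
    also have "\<dots> = mat N N (\<lambda>(i, j). C $$ (i, j)) *\<^sub>v vec N (\<lambda>i. \<Sum>k<N. M i k * x k)"
      using Ceq by (simp add: mat_mult_vec_sum)
    also have "\<dots> = vec N (\<lambda>i. \<Sum>j<N. C $$ (i, j) * (\<Sum>k<N. M j k * x k))"
      by (rule mat_mult_vec_sum)
    finally have "vec_index (vec N x) i = vec_index (vec N (\<lambda>i. \<Sum>j<N. C $$ (i, j) * (\<Sum>k<N. M j k * x k))) i" by simp
    then show ?thesis using i by simp
  qed
  then show ?thesis by (intro that[of "\<lambda>i j. C $$ (i, j)"])
qed

section \<open>Differentiability of the Perron eigenpair\<close>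

text \<open>Pairing with the left eigenvector of the unperturbed matrix expresses the change of the
  root exactly through the change of the matrix, with no remainder to estimate.\<close>

lemma perron_root_difference:
  fixes u0 :: "nat \<Rightarrow> real"
  assumes v: "perron_pair N W l v"
    and u0: "\<And>j. j < N \<Longrightarrow> (\<Sum>i<N. W0 i j * u0 i) = l0 * u0 j"
  shows "(l - l0) * (\<Sum>i<N. u0 i * v i) = (\<Sum>i<N. u0 i * (\<Sum>j<N. (W i j - W0 i j) * v j))"
proof -
  have "(\<Sum>i<N. u0 i * (\<Sum>j<N. W i j * v j)) = l * (\<Sum>i<N. u0 i * v i)"
    using perron_pairD(3)[OF v] by (simp add: sum_distrib_left mult_ac)
  moreover have "(\<Sum>i<N. u0 i * (\<Sum>j<N. W0 i j * v j)) = l0 * (\<Sum>i<N. u0 i * v i)"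
    by (rule left_eigenvector_pairing) (rule u0)
  ultimately show ?thesis
    by (simp add: left_diff_distrib right_diff_distrib sum_subtractf)
qed

text \<open>The witness is the inverse of \<open>W - l I + v 1\<^sup>T\<close>.\<close>

lemma perron_left_inverse:
  assumes W: "perron_matrix N W" and v: "perron_pair N W l v"
  obtains B where "\<And>x i. (\<Sum>j<N. x j) = 0 \<Longrightarrow> i < N \<Longrightarrow>
    x i = (\<Sum>j<N. B i j * ((\<Sum>k<N. W j k * x k) - l * x j))"
proof -
  have N: "0 < N" using W by (simp add: perron_matrix_def)
  obtain k u where u: "perron_pair N (\<lambda>i j. W j i) k u"
    using perron_pair_exists[OF perron_matrix_transpose[OF W]] by blast
  have "k = l" using perron_pair_left_right_root[OF N v u] .
  note u = perron_pairD[OF u[unfolded \<open>k = l\<close>]] and v' = perron_pairD[OF v]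
  define M where "M i j = W i j - (if i = j then l else 0) + v i" for i j
  have M: "(\<Sum>j<N. M i j * x j) = (\<Sum>j<N. W i j * x j) - l * x i + v i * (\<Sum>j<N. x j)" if "i < N" for i x
  proof -
    have "M i j * x j = W i j * x j - (if i = j then l * x j else 0) + v i * x j" for j
      by (simp add: M_def algebra_simps)
    then show ?thesis using that by (simp add: sum.distrib sum_subtractf sum_distrib_left)
  qed
  have inj: "x i = 0" if x: "\<And>i. i < N \<Longrightarrow> (\<Sum>j<N. M i j * x j) = 0" and i: "i < N" for x i
  proof -
    define s where "s = (\<Sum>j<N. x j)"
    have Wx: "(\<Sum>j<N. W i j * x j) = l * x i - v i * s" if "i < N" for i
      using x[OF that] M[OF that, of x] by (simp add: s_def)
    \<comment> \<open>Pairing \<open>M x = 0\<close> with \<open>u\<close> removes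
      \<open>W - l I\<close> and leaves \<open>s\<close> times a positive number.\<close>
    have "(\<Sum>i<N. u i * (l * x i - v i * s)) = l * (\<Sum>i<N. u i * x i)"
      using left_eigenvector_pairing[of N W u l x, OF u(3)] Wx by simp
    then have "s * (\<Sum>i<N. u i * v i) = 0"
      by (simp add: right_diff_distrib sum_subtractf sum_distrib_left mult_ac)
    moreover have "0 < (\<Sum>i<N. u i * v i)" by (rule perron_pair_pairing_pos[OF v N u(1)])
    ultimately have "s = 0" by simp
    then have "(\<Sum>j<N. W i j * x j) = l * x i" if "i < N" for i using Wx[OF that] by simp
    then obtain c where c: "\<forall>i<N. x i = c * v i" using eigenvector_unique[OF W v'(1,3)] by blast
    then have "s = c" using v'(2) by (simp add: s_def sum_distrib_left[symmetric])
    then show ?thesis using c \<open>s = 0\<close> i by simp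
  qed
  then have "\<forall>x. (\<forall>i<N. (\<Sum>j<N. M i j * x j) = 0) \<longrightarrow> (\<forall>i<N. x i = 0)" by blast
  then obtain B where B: "\<And>x i. i < N \<Longrightarrow> (\<Sum>j<N. B i j * (\<Sum>k<N. M j k * x k)) = x i"
    by (rule left_inverse_exists) blast
  show ?thesis
  proof (rule that)
    fix x :: "nat \<Rightarrow> real" and i assume x: "(\<Sum>j<N. x j) = 0" and i: "i < (N::nat)"
    show "x i = (\<Sum>j<N. B i j * ((\<Sum>k<N. W j k * x k) - l * x j))"
      using B[OF i, of x] x by (simp add: M)
  qed
qed

lemma perron_pair_le_1:
  assumes "perron_pair N W l v" "i < N"
  shows "\<bar>v i\<bar> \<le> 1"
proof -
  have "v i \<le> (\<Sum>i<N. v i)"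
    by (rule member_le_sum) (use assms in \<open>auto simp: perron_pair_def less_imp_le\<close>)
  then show ?thesis using perron_pairD[OF assms(1)] assms(2) by (force simp: abs_of_pos)
qed

lemma tendsto_zero_mult_bounded:
  fixes f g :: "'b \<Rightarrow> real"
  assumes "(f \<longlongrightarrow> 0) F" "\<And>t. \<bar>g t\<bar> \<le> 1"
  shows "((\<lambda>t. f t * g t) \<longlongrightarrow> 0) F"
proof (rule Lim_null_comparison)
  show "((\<lambda>t. \<bar>f t\<bar>) \<longlongrightarrow> 0) F" using assms(1) by (rule tendsto_rabs_zero)
  show "\<forall>\<^sub>F t in F. norm (f t * g t) \<le> \<bar>f t\<bar>"
    using assms(2) by (intro always_eventually allI) (simp add: abs_mult mult_left_le)
qed

text \<open>In the difference identity the entries of \<open>v t\<close> are at most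
  \<open>1\<close>, and the pairing is at least the smallest entry \<open>m\<close> of
  \<open>u\<close>, since \<open>v t\<close> sums to \<open>1\<close>. Hence \<open>D t / m\<close>
  controls the change of the root.\<close>

lemma perron_root_tendsto:
  assumes W0: "perron_matrix N W0" and v0: "perron_pair N W0 l0 v0"
    and v: "\<And>t. perron_pair N (W t) (l t) (v t)"
    and lim: "\<And>i j. i < N \<Longrightarrow> j < N \<Longrightarrow> ((\<lambda>t. W t i j) \<longlongrightarrow> W0 i j) F"
  shows "(l \<longlongrightarrow> l0) F"
proof -
  have N: "0 < N" using W0 by (simp add: perron_matrix_def)
  obtain k u where u: "perron_pair N (\<lambda>i j. W0 j i) k u"
    using perron_pair_exists[OF perron_matrix_transpose[OF W0]] by blast
  have "k = l0" using perron_pair_left_right_root[OF N v0 u] .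
  note u = perron_pairD[OF u[unfolded \<open>k = l0\<close>]]
  define m where "m = Min (u ` {..<N})"
  have m: "0 < m" unfolding m_def using N u by (subst Min_gr_iff) auto
  have m_le: "m \<le> u i" if "i < N" for i using that by (auto simp: m_def)
  define D where "D t = (\<Sum>i<N. u i * (\<Sum>j<N. \<bar>W t i j - W0 i j\<bar>))" for t
  have "(D \<longlongrightarrow> (\<Sum>i<N. u i * (\<Sum>j<N. \<bar>W0 i j - W0 i j\<bar>))) F"
    unfolding D_def by (intro tendsto_intros lim) auto
  then have "((\<lambda>t. D t / m) \<longlongrightarrow> 0) F" using tendsto_divide_zero by simp
  moreover have "norm (l t - l0) \<le> D t / m" for t
  proof -
    have "m = (\<Sum>i<N. m * v t i)"
      using perron_pairD(2)[OF v] by (simp add: sum_distrib_left[symmetric])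
    also have "\<dots> \<le> (\<Sum>i<N. u i * v t i)"
      using m_le perron_pairD(1)[OF v] by (intro sum_mono mult_right_mono) (auto simp: less_imp_le)
    finally have S: "m \<le> (\<Sum>i<N. u i * v t i)" .
    have "\<bar>l t - l0\<bar> * m \<le> \<bar>l t - l0\<bar> * (\<Sum>i<N. u i * v t i)"
      using S by (rule mult_left_mono) simp
    also have "\<dots> = \<bar>(l t - l0) * (\<Sum>i<N. u i * v t i)\<bar>"
      using S m by (simp add: abs_mult)
    also have "\<dots> = \<bar>\<Sum>i<N. u i * (\<Sum>j<N. (W t i j - W0 i j) * v t j)\<bar>"
      by (subst perron_root_difference[OF v u(3)]) auto
    also have "\<dots> \<le> (\<Sum>i<N. \<bar>u i * (\<Sum>j<N. (W t i j - W0 i j) * v t j)\<bar>)"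
      by (rule sum_abs)
    also have "\<dots> \<le> D t" unfolding D_def
    proof (rule sum_mono)
      fix i assume "i \<in> {..<N}"
      have "\<bar>\<Sum>j<N. (W t i j - W0 i j) * v t j\<bar> \<le> (\<Sum>j<N. \<bar>(W t i j - W0 i j) * v t j\<bar>)"
        by (rule sum_abs)
      also have "\<dots> \<le> (\<Sum>j<N. \<bar>W t i j - W0 i j\<bar>)"
        using perron_pair_le_1[OF v] by (intro sum_mono) (simp add: abs_mult mult_left_le)
      finally show "\<bar>u i * (\<Sum>j<N. (W t i j - W0 i j) * v t j)\<bar> \<le> u i * (\<Sum>j<N. \<bar>W t i j - W0 i j\<bar>)"
        using u(1)[of i] \<open>i \<in> _\<close> by (simp add: abs_mult mult_left_mono)
    qed
    finally show ?thesis using m by (simp add: field_simps)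
  qed
  ultimately have "((\<lambda>t. l t - l0) \<longlongrightarrow> 0) F"
    by (intro Lim_null_comparison[of "\<lambda>t. l t - l0" "\<lambda>t. D t / m"]) auto
  then show ?thesis by (rule LIM_zero_cancel)
qed

text \<open>Both difference quotients are rational expressions in the difference quotients of \<open>W\<close> and in
  \<open>v t\<close>, which is bounded because it lies in the simplex; hence boundedness of \<open>v\<close> gives its continuity,
  and continuity gives differentiability.\<close>

lemma perron_pair_derivatives:
  fixes W :: "real \<Rightarrow> nat \<Rightarrow> nat \<Rightarrow> real"
  assumes W: "\<And>t. perron_matrix N (W t)"
    and v: "\<And>t. perron_pair N (W t) (l t) (v t)"
    and dW: "\<And>i j. i < N \<Longrightarrow> j < N \<Longrightarrow> ((\<lambda>t. W t i j) has_real_derivative W' i j) (at t0)"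
  obtains l' v' where "(l has_real_derivative l') (at t0)"
    and "\<And>i. i < N \<Longrightarrow> ((\<lambda>t. v t i) has_real_derivative v' i) (at t0)"
    and "(\<Sum>i<N. v' i) = 0"
    and "\<And>i. i < N \<Longrightarrow> (\<Sum>j<N. W' i j * v t0 j) + (\<Sum>j<N. W t0 i j * v' j) = l' * v t0 i + l t0 * v' i"
proof -
  have N: "0 < N" using W by (simp add: perron_matrix_def)
  obtain k u where u: "perron_pair N (\<lambda>i j. W t0 j i) k u"
    using perron_pair_exists[OF perron_matrix_transpose[OF W]] by blast
  have "k = l t0" using perron_pair_left_right_root[OF N v u] .
  note u = perron_pairD[OF u[unfolded \<open>k = l t0\<close>]]
  have S0: "(\<Sum>i<N. u i * v t i) \<noteq> 0" for t
    using perron_pair_pairing_pos[OF v[of t] N, of u] u(1) by force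
  have limW: "((\<lambda>t. W t i j) \<longlongrightarrow> W t0 i j) (at t0)" if "i < N" "j < N" for i j
    using DERIV_isCont[OF dW[OF that]] by (simp add: isCont_def)
  have liml: "(l \<longlongrightarrow> l t0) (at t0)"
    by (rule perron_root_tendsto[OF W v v limW])
  obtain B where B: "\<And>x i. (\<Sum>j<N. x j) = 0 \<Longrightarrow> i < N \<Longrightarrow>
      x i = (\<Sum>j<N. B i j * ((\<Sum>k<N. W t0 j k * x k) - l t0 * x j))"
    by (rule perron_left_inverse[OF W v[of t0]]) blast
  \<comment> \<open>The difference of two normalized vectors has sum zero, so \<open>B\<close>
    recovers it from its residual in the unperturbed equation; the two eigenvalue equations express
    this residual through the changes of \<open>W\<close> and \<open>l\<close>.\<close>
  have dv: "v t i - v t0 i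
      = - (\<Sum>j<N. B i j * ((\<Sum>k<N. (W t j k - W t0 j k) * v t k) - (l t - l t0) * v t j))"
    if i: "i < N" for t i
  proof -
    have "v t i - v t0 i = (\<Sum>j<N. B i j *
        ((\<Sum>k<N. W t0 j k * (v t k - v t0 k)) - l t0 * (v t j - v t0 j)))"
      using B[of "\<lambda>i. v t i - v t0 i", OF _ i] perron_pairD(2)[OF v] by (simp add: sum_subtractf)
    also have "\<dots> = (\<Sum>j<N. B i j *
        - ((\<Sum>k<N. (W t j k - W t0 j k) * v t k) - (l t - l t0) * v t j))"
    proof (rule sum.cong[OF refl], rule arg_cong[where f = "(*) _"])
      fix j assume "j \<in> {..<N}"
      then have j: "j < N" by simp
      show "(\<Sum>k<N. W t0 j k * (v t k - v t0 k)) - l t0 * (v t j - v t0 j)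
        = - ((\<Sum>k<N. (W t j k - W t0 j k) * v t k) - (l t - l t0) * v t j)"
        using perron_pairD(3)[OF v j, of t] perron_pairD(3)[OF v j, of t0]
        by (simp add: right_diff_distrib left_diff_distrib sum_subtractf)
    qed
    finally show ?thesis by (simp only: mult_minus_right sum_negf)
  qed
  have null: "((\<lambda>t. f t * v t j) \<longlongrightarrow> 0) F" if "(f \<longlongrightarrow> 0) F" "j < N" for f j F
    by (rule tendsto_zero_mult_bounded[OF that(1) perron_pair_le_1[OF v that(2)]])
  have limv: "((\<lambda>t. v t i) \<longlongrightarrow> v t0 i) (at t0)" if i: "i < N" for i
  proof -
    have "((\<lambda>t. - (\<Sum>j<N. B i j * ((\<Sum>k<N. (W t j k - W t0 j k) * v t k) - (l t - l t0) * v t j)))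
        \<longlongrightarrow> - (\<Sum>j<N. B i j * ((\<Sum>k<N. 0) - 0))) (at t0)"
      by (intro tendsto_intros null LIM_zero limW liml) auto
    then have "((\<lambda>t. v t i - v t0 i) \<longlongrightarrow> 0) (at t0)" by (simp add: dv[OF i])
    then show ?thesis by (rule LIM_zero_cancel)
  qed
  define l' where "l' = (\<Sum>i<N. u i * (\<Sum>j<N. W' i j * v t0 j)) / (\<Sum>i<N. u i * v t0 i)"
  define v' where "v' i = - (\<Sum>j<N. B i j * ((\<Sum>k<N. W' j k * v t0 k) - l' * v t0 j))" for i
  have qW: "((\<lambda>t. (W t i j - W t0 i j) / (t - t0)) \<longlongrightarrow> W' i j) (at t0)" if "i < N" "j < N" for i j
    using dW[OF that] by (simp add: has_field_derivative_iff)
  have ql: "((\<lambda>t. (l t - l t0) / (t - t0)) \<longlongrightarrow> l') (at t0)"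
  proof -
    have "(l t - l t0) / (t - t0) = (\<Sum>i<N. u i * (\<Sum>j<N. (W t i j - W t0 i j) / (t - t0) * v t j))
        / (\<Sum>i<N. u i * v t i)" for t
    proof -
      have "l t - l t0 = (\<Sum>i<N. u i * (\<Sum>j<N. (W t i j - W t0 i j) * v t j)) / (\<Sum>i<N. u i * v t i)"
        using perron_root_difference[OF v u(3), of t] S0[of t] by (simp add: field_simps)
      then show ?thesis
        by (simp add: sum_divide_distrib sum_distrib_left mult_ac)
    qed
    then show ?thesis
      unfolding l'_def by (simp only:) (intro tendsto_intros qW limv S0; simp)
  qed
  have qv: "((\<lambda>t. (v t i - v t0 i) / (t - t0)) \<longlongrightarrow> v' i) (at t0)" if i: "i < N" for i
  proof -
    have quotient: "- (\<Sum>j<N. b j * ((\<Sum>k<N. w j k * y k) - d * y j)) / s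
        = - (\<Sum>j<N. b j * ((\<Sum>k<N. w j k / s * y k) - d / s * y j))" for b y :: "nat \<Rightarrow> real" and w d s
      by (simp add: sum_divide_distrib diff_divide_distrib right_diff_distrib sum_distrib_left mult_ac)
    have "(v t i - v t0 i) / (t - t0) = - (\<Sum>j<N. B i j *
        ((\<Sum>k<N. (W t j k - W t0 j k) / (t - t0) * v t k) - (l t - l t0) / (t - t0) * v t j))" for t
      unfolding dv[OF i] by (rule quotient)
    then show ?thesis
      unfolding v'_def by (simp only:) (intro tendsto_intros qW ql limv; simp)
  qed
  have Dl: "(l has_real_derivative l') (at t0)"
    using ql by (simp add: has_field_derivative_iff)
  have Dv: "((\<lambda>t. v t i) has_real_derivative v' i) (at t0)" if "i < N" for i
    using qv[OF that] by (simp add: has_field_derivative_iff)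
  \<comment> \<open>With the derivatives at hand, the remaining claims are the differentiated
    normalization and the differentiated eigenvalue equation.\<close>
  have "((\<lambda>t. \<Sum>i<N. v t i) has_real_derivative (\<Sum>i<N. v' i)) (at t0)"
    using Dv by (intro DERIV_sum) auto
  then have "(\<Sum>i<N. v' i) = 0"
    using perron_pairD(2)[OF v] DERIV_unique[OF _ DERIV_const] by simp
  moreover have "(\<Sum>j<N. W' i j * v t0 j) + (\<Sum>j<N. W t0 i j * v' j) = l' * v t0 i + l t0 * v' i"
    if i: "i < N" for i
  proof -
    have "((\<lambda>t. \<Sum>j<N. W t i j * v t j) has_real_derivative
        (\<Sum>j<N. W' i j * v t0 j + v' j * W t0 i j)) (at t0)"
      using dW Dv i by (intro DERIV_sum DERIV_mult') (auto intro!: DERIV_cong[OF DERIV_mult])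
    moreover have "((\<lambda>t. l t * v t i) has_real_derivative (l' * v t0 i + v' i * l t0)) (at t0)"
      by (rule DERIV_mult[OF Dl Dv[OF i]])
    ultimately show ?thesis
      using DERIV_unique perron_pairD(3)[OF v i] by (simp add: sum.distrib mult_ac)
  qed
  ultimately show ?thesis using that Dl Dv by blast
qed

text \<open>First-order perturbation formula: after pairing with the left eigenvector, the unknown
  \<open>v'\<close> contributes the same amount to both sides and cancels.\<close>

lemma perron_root_derivative_pairing:
  fixes W :: "nat \<Rightarrow> nat \<Rightarrow> real"
  assumes u: "\<And>j. j < N \<Longrightarrow> (\<Sum>i<N. W i j * u i) = l * u j"
    and eq: "\<And>i. i < N \<Longrightarrow> (\<Sum>j<N. W' i j * v j) + (\<Sum>j<N. W i j * v' j) = l' * v i + l * v' i"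
  shows "l' * (\<Sum>i<N. u i * v i) = (\<Sum>i<N. u i * (\<Sum>j<N. W' i j * v j))"
proof -
  have "(\<Sum>i<N. u i * ((\<Sum>j<N. W' i j * v j) + (\<Sum>j<N. W i j * v' j)))
      = (\<Sum>i<N. u i * (l' * v i + l * v' i))"
    using eq by simp
  then show ?thesis
    using left_eigenvector_pairing[of N W u l v', OF u]
    by (simp add: distrib_left sum.distrib sum_distrib_left mult_ac)
qed

section \<open>Networks and the tilted generator\<close>

text \<open>One sum over edges for all entries, diagonal included: each direction of an edge
  contributes a tilted jump into its end and an untilted exit from its start. In this form the
  entries can be differentiated edge by edge.\<close>

definition tilted_entry ::
    "(nat, 'e) pre_digraph \<Rightarrow> ('e \<Rightarrow> real) \<Rightarrow> ('e \<Rightarrow> real) \<Rightarrow> ('e \<Rightarrow> real) \<Rightarrow> nat \<Rightarrow> nat \<Rightarrow> real" where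
  "tilted_entry G wp wm c l m = (\<Sum>e\<in>arcs G.
     wp e * (exp (c e) * of_bool (l = head G e) - of_bool (l = tail G e)) * of_bool (m = tail G e) +
     wm e * (exp (- c e) * of_bool (l = tail G e) - of_bool (l = head G e)) * of_bool (m = head G e))"

text \<open>Being linear in the rates, it also represents the derivative of the generator, with
  derivatives of the rates in place of \<open>wp\<close> and \<open>wm\<close>.\<close>

abbreviation generator_entry ::
    "(nat, 'e) pre_digraph \<Rightarrow> ('e \<Rightarrow> real) \<Rightarrow> ('e \<Rightarrow> real) \<Rightarrow> nat \<Rightarrow> nat \<Rightarrow> real" where
  "generator_entry G wp wm \<equiv> tilted_entry G wp wm (\<lambda>_. 0)"

text \<open>The derivative of \<open>tilted_entry\<close> with respect to \<open>c e\<close> at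
  \<open>c e = s\<close>.\<close>

definition edge_tilt ::
    "(nat, 'e) pre_digraph \<Rightarrow> ('e \<Rightarrow> real) \<Rightarrow> ('e \<Rightarrow> real) \<Rightarrow> 'e \<Rightarrow> real \<Rightarrow> nat \<Rightarrow> nat \<Rightarrow> real" where
  "edge_tilt G wp wm e s l m =
     wp e * exp s * of_bool (l = head G e) * of_bool (m = tail G e) -
     wm e * exp (- s) * of_bool (l = tail G e) * of_bool (m = head G e)"

text \<open>The linear functional \<open>j\<^sub>e\<close>; at the stationary vector it is the
  current through \<open>e\<close>.\<close>

definition edge_flow ::
    "(nat, 'e) pre_digraph \<Rightarrow> ('e \<Rightarrow> real) \<Rightarrow> ('e \<Rightarrow> real) \<Rightarrow> 'e \<Rightarrow> (nat \<Rightarrow> real) \<Rightarrow> real" where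
  "edge_flow G wp wm e x = wp e * x (tail G e) - wm e * x (head G e)"

definition positive_rates :: "(nat, 'e) pre_digraph \<Rightarrow> ('e \<Rightarrow> real) \<Rightarrow> ('e \<Rightarrow> real) \<Rightarrow> bool" where
  "positive_rates G wp wm \<longleftrightarrow> (\<forall>e\<in>arcs G. 0 < wp e \<and> 0 < wm e)"

text \<open>The common first-order response of the stationary vector \<open>p\<close> to the counting variable and to the
  force of a stalled edge.\<close>

definition edge_response ::
    "nat \<Rightarrow> (nat, 'e) pre_digraph \<Rightarrow> ('e \<Rightarrow> real) \<Rightarrow> ('e \<Rightarrow> real) \<Rightarrow> (nat \<Rightarrow> real) \<Rightarrow> 'e \<Rightarrow> (nat \<Rightarrow> real) \<Rightarrow> bool"
  where
  "edge_response N G wp wm p e x \<longleftrightarrow> (\<Sum>i<N. x i) = 0 \<and>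
     (\<forall>i<N. (\<Sum>j<N. generator_entry G wp wm i j * x j) =
        - (wp e * p (tail G e)) * (of_bool (i = head G e) - of_bool (i = tail G e)))"

section \<open>Connectedness and irreducibility\<close>

lemma networkD:
  assumes "network N G"
  shows "finite (arcs G)" "0 < N"
    and "e \<in> arcs G \<Longrightarrow> tail G e < N" "e \<in> arcs G \<Longrightarrow> head G e < N"
    and "e \<in> arcs G \<Longrightarrow> tail G e \<noteq> head G e"
proof -
  interpret fin_digraph G using assms by (simp add: network_def)
  interpret loopfree_digraph G using assms by (simp add: network_def)
  have verts: "verts G = {..<N}" and con: "Digraph_Component.connected G"
    using assms by (auto simp: network_def)
  show "finite (arcs G)" by simp
  show "0 < N" using con verts
    by (auto simp: Digraph_Component.connected_def strongly_connected_def)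
  show "e \<in> arcs G \<Longrightarrow> tail G e < N" "e \<in> arcs G \<Longrightarrow> head G e < N"
    using tail_in_verts[of e] head_in_verts[of e] verts by auto
  show "e \<in> arcs G \<Longrightarrow> tail G e \<noteq> head G e" by (rule no_loops)
qed

text \<open>Without an edge across the boundary of \<open>S\<close>, no path of the symmetrized
  graph could leave \<open>S\<close>, against connectedness.\<close>

lemma network_cut_edge:
  assumes net: "network N G" and S: "S \<noteq> {}" "S \<subset> {..<N}"
  shows "\<exists>e\<in>arcs G. (tail G e \<in> S) \<noteq> (head G e \<in> S)"
proof (rule ccontr)
  assume no: "\<not> ?thesis"
  interpret fin_digraph G using net by (simp add: network_def)
  interpret sym: pair_wf_digraph "mk_symmetric G" by (rule wellformed_mk_symmetric)
  obtain a b where ab: "a \<in> S" "b < N" "b \<notin> S" using S by auto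
  have "a \<rightarrow>\<^sup>*\<^bsub>mk_symmetric G\<^esub> b"
    using net ab S by (auto simp: network_def Digraph_Component.connected_def strongly_connected_def)
  then have "b \<in> S"
  proof (induction rule: sym.reachable_induct)
    case base
    show ?case by (rule ab)
  next
    case (step x y)
    then show ?case using no by (auto simp: parcs_mk_symmetric)
  qed
  then show False using ab by simp
qed

lemma tilted_generator_eq:
  assumes net: "network N G"
  shows "tilted_generator N G E' wp wm q =
    mat N N (\<lambda>(l, m). tilted_entry G wp wm (counting_variable E' q) l m)"
proof (rule eq_matI)
  fix l m
  assume "l < dim_row (mat N N (\<lambda>(l, m). tilted_entry G wp wm (counting_variable E' q) l m))"
    and "m < dim_col (mat N N (\<lambda>(l, m). tilted_entry G wp wm (counting_variable E' q) l m))"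
  then have "l < N" "m < N" by auto
  moreover note fin = networkD(1)[OF net]
  note loop = networkD(5)[OF net]
  have "(\<Sum>e | e \<in> arcs G \<and> tail G e = m \<and> head G e = l. wp e * exp (counting_variable E' q e)) +
       (\<Sum>e | e \<in> arcs G \<and> head G e = m \<and> tail G e = l. wm e * exp (- counting_variable E' q e))
     = tilted_entry G wp wm (counting_variable E' q) l m" if "l \<noteq> m"
    unfolding tilted_entry_def sum.inter_filter[OF fin] sum.distrib[symmetric]
    by (rule sum.cong) (use that in auto)
  \<comment> \<open>On the diagonal the jump terms drop out because no edge is a loop, leaving the
    exit rates.\<close>
  moreover have "- ((\<Sum>e | e \<in> arcs G \<and> tail G e = m. wp e) + (\<Sum>e | e \<in> arcs G \<and> head G e = m. wm e))
     = tilted_entry G wp wm (counting_variable E' q) m m"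
    unfolding tilted_entry_def sum.inter_filter[OF fin] sum.distrib[symmetric] sum_negf[symmetric]
    by (rule sum.cong) (use loop in \<open>auto dest: loop\<close>)
  ultimately show "tilted_generator N G E' wp wm q $$ (l, m)
      = mat N N (\<lambda>(l, m). tilted_entry G wp wm (counting_variable E' q) l m) $$ (l, m)"
    by (auto simp: tilted_generator_def)
qed (auto simp: tilted_generator_def)

text \<open>Both directions of an edge have positive rate, so an edge across a cut gives a positive
  entry out of \<open>S\<close> whichever way it is oriented.\<close>

lemma perron_matrix_tilted:
  assumes net: "network N G" and pos: "positive_rates G wp wm"
  shows "perron_matrix N (tilted_entry G wp wm c)"
proof -
  let ?term = "\<lambda>e l m.
     wp e * (exp (c e) * of_bool (l = head G e) - of_bool (l = tail G e)) * of_bool (m = tail G e) +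
     wm e * (exp (- c e) * of_bool (l = tail G e) - of_bool (l = head G e)) * of_bool (m = head G e)"
  have term_nn: "0 \<le> ?term e l m" if "e \<in> arcs G" "l \<noteq> m" for e l m
    using that pos by (auto simp: positive_rates_def less_imp_le)
  have "\<exists>j\<in>S. \<exists>i\<in>{..<N} - S. 0 < tilted_entry G wp wm c i j" if S: "S \<noteq> {}" "S \<subset> {..<N}" for S
  proof -
    obtain e where e: "e \<in> arcs G" "(tail G e \<in> S) \<noteq> (head G e \<in> S)"
      using network_cut_edge[OF net S] by blast
    define j i where "j = (if tail G e \<in> S then tail G e else head G e)"
      and "i = (if tail G e \<in> S then head G e else tail G e)"
    have "j \<in> S" "i \<in> {..<N} - S" "i \<noteq> j"
      using e(2) networkD(3-5)[OF net e(1)] by (cases "tail G e \<in> S"; simp add: i_def j_def)+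
    moreover have "0 < ?term e i j"
      using e(1) networkD(5)[OF net e(1)] pos by (cases "tail G e \<in> S") (simp_all add: i_def j_def positive_rates_def)
    moreover have "?term e i j \<le> tilted_entry G wp wm c i j"
      unfolding tilted_entry_def
      by (rule member_le_sum[where f = "\<lambda>e. ?term e i j"])
        (use e term_nn \<open>i \<noteq> j\<close> networkD(1)[OF net] in auto)
    ultimately show ?thesis by (meson less_le_trans)
  qed
  then show ?thesis
    using networkD(2)[OF net] term_nn by (auto simp: perron_matrix_def tilted_entry_def intro!: sum_nonneg)
qed

text \<open>Choice makes the eigenvector a function of the matrix, so that it can be differentiated
  along a curve. For a \<open>perron_matrix\<close> its values on \<open>{..<N}\<close> are uniquely
  determined.\<close>

definition perron_vector :: "nat \<Rightarrow> (nat \<Rightarrow> nat \<Rightarrow> real) \<Rightarrow> nat \<Rightarrow> real" where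
  "perron_vector N W = (SOME v. \<exists>l. perron_pair N W l v)"

lemma perron_pair_perron_vector:
  assumes "perron_matrix N W"
  shows "perron_pair N W (dominant_eigenvalue (mat N N (\<lambda>(i, j). W i j))) (perron_vector N W)"
proof -
  have "\<exists>l. perron_pair N W l (perron_vector N W)"
    unfolding perron_vector_def
    using someI_ex[of "\<lambda>v. \<exists>l. perron_pair N W l v"] perron_pair_exists[OF assms] by blast
  then show ?thesis using dominant_eigenvalue_perron[OF assms] by metis
qed

lemma scgf_perron_pair:
  assumes net: "network N G" and pos: "positive_rates G wp wm"
  shows "perron_pair N (tilted_entry G wp wm (counting_variable E' q)) (scgf N G E' wp wm q)
    (perron_vector N (tilted_entry G wp wm (counting_variable E' q)))"
  unfolding scgf_def tilted_generator_eq[OF net]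
  by (rule perron_pair_perron_vector[OF perron_matrix_tilted[OF net pos]])

lemma scgf_left_perron_pair:
  assumes net: "network N G" and pos: "positive_rates G wp wm"
  shows "perron_pair N (\<lambda>i j. tilted_entry G wp wm (counting_variable E' q) j i) (scgf N G E' wp wm q)
    (perron_vector N (\<lambda>i j. tilted_entry G wp wm (counting_variable E' q) j i))"
proof -
  have "perron_matrix N (\<lambda>i j. tilted_entry G wp wm (counting_variable E' q) j i)"
    by (rule perron_matrix_transpose[OF perron_matrix_tilted[OF net pos]])
  note u = perron_pair_perron_vector[OF this]
  show ?thesis
    using u perron_pair_left_right_root[OF networkD(2)[OF net] scgf_perron_pair[OF net pos] u] by simp
qed

section \<open>Action of the generator and of its counting derivative on vectors\<close>

lemma sum_of_bool_mult:
  fixes f :: "nat \<Rightarrow> real"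
  assumes "k < N"
  shows "(\<Sum>i<N. f i * of_bool (i = k)) = f k" "(\<Sum>i<N. of_bool (i = k) * f i) = f k"
  using assms by (simp_all add: of_bool_def if_distrib if_distribR cong: if_cong)

lemma tilted_entry_action:
  assumes net: "network N G"
  shows "(\<Sum>m<N. tilted_entry G wp wm c l m * x m) = (\<Sum>e\<in>arcs G.
     wp e * (exp (c e) * of_bool (l = head G e) - of_bool (l = tail G e)) * x (tail G e) +
     wm e * (exp (- c e) * of_bool (l = tail G e) - of_bool (l = head G e)) * x (head G e))"
proof -
  have "(\<Sum>m<N. (A * of_bool (m = tail G e) + B * of_bool (m = head G e)) * x m)
      = A * x (tail G e) + B * x (head G e)" if "e \<in> arcs G" for A B e
    using sum_of_bool_mult[of "tail G e" N x] sum_of_bool_mult[of "head G e" N x]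
      networkD(3,4)[OF net that]
    by (simp add: distrib_right sum.distrib mult.assoc sum_distrib_left[symmetric])
  then show ?thesis
    unfolding tilted_entry_def sum_distrib_right by (subst sum.swap) (intro sum.cong refl)
qed

lemma generator_entry_action:
  assumes net: "network N G"
  shows "(\<Sum>m<N. generator_entry G wp wm l m * x m) =
    (\<Sum>e\<in>arcs G. edge_flow G wp wm e x * (of_bool (l = head G e) - of_bool (l = tail G e)))"
  unfolding tilted_entry_action[OF net] edge_flow_def by (intro sum.cong) (auto simp: algebra_simps)

lemma generator_column_sum:
  assumes net: "network N G"
  shows "(\<Sum>l<N. \<Sum>m<N. generator_entry G wp wm l m * x m) = 0"
proof -
  have "(\<Sum>l<N. edge_flow G wp wm e x * (of_bool (l = head G e) - of_bool (l = tail G e))) = 0"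
    if "e \<in> arcs G" for e
    using sum_of_bool_mult(1)[of "head G e" N "\<lambda>_. 1"] sum_of_bool_mult(1)[of "tail G e" N "\<lambda>_. 1"]
      networkD(3,4)[OF net that] by (simp add: sum_distrib_left[symmetric] sum_subtractf)
  then show ?thesis
    unfolding generator_entry_action[OF net] by (subst sum.swap) simp
qed

lemma edge_tilt_action:
  assumes net: "network N G" and e: "e \<in> arcs G"
  shows "(\<Sum>m<N. edge_tilt G wp wm e s l m * x m) =
    wp e * exp s * of_bool (l = head G e) * x (tail G e) -
    wm e * exp (- s) * of_bool (l = tail G e) * x (head G e)"
  using sum_of_bool_mult[of "tail G e" N x] sum_of_bool_mult[of "head G e" N x]
    networkD(3,4)[OF net e]
  by (simp add: edge_tilt_def left_diff_distrib sum_subtractf mult.assoc sum_distrib_left[symmetric])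

lemma edge_tilt_form:
  assumes net: "network N G" and e: "e \<in> arcs G"
  shows "(\<Sum>l<N. u l * (\<Sum>m<N. edge_tilt G wp wm e s l m * x m)) =
    wp e * exp s * u (head G e) * x (tail G e) - wm e * exp (- s) * u (tail G e) * x (head G e)"
proof -
  have "(\<Sum>l<N. u l * (a * of_bool (l = head G e) * b - c * of_bool (l = tail G e) * d))
      = a * u (head G e) * b - c * u (tail G e) * d" for a b c d
  proof -
    have "(\<Sum>l<N. u l * (a * of_bool (l = head G e) * b - c * of_bool (l = tail G e) * d))
        = (\<Sum>l<N. of_bool (l = head G e) * (a * u l * b)) - (\<Sum>l<N. of_bool (l = tail G e) * (c * u l * d))"
      unfolding sum_subtractf[symmetric] by (rule sum.cong) (simp_all add: algebra_simps)
    then show ?thesis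
      by (simp only: sum_of_bool_mult(2)[OF networkD(4)[OF net e]] sum_of_bool_mult(2)[OF networkD(3)[OF net e]])
  qed
  then show ?thesis unfolding edge_tilt_action[OF net e] by simp
qed

lemma DERIV_tilted_entry:
  assumes net: "network N G" and e: "e \<in> arcs G"
  shows "((\<lambda>t. tilted_entry G wp wm (c(e := t)) l m) has_real_derivative edge_tilt G wp wm e t0 l m) (at t0)"
proof -
  let ?term = "\<lambda>t a.
     wp a * (exp ((c(e := t)) a) * of_bool (l = head G a) - of_bool (l = tail G a)) * of_bool (m = tail G a) +
     wm a * (exp (- (c(e := t)) a) * of_bool (l = tail G a) - of_bool (l = head G a)) * of_bool (m = head G a)"
  have "((\<lambda>t. ?term t a) has_real_derivative (if a = e then edge_tilt G wp wm e t0 l m else 0)) (at t0)" for a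
    by (cases "a = e") (auto simp: edge_tilt_def intro!: derivative_eq_intros)
  then have "((\<lambda>t. \<Sum>a\<in>arcs G. ?term t a) has_real_derivative
      (\<Sum>a\<in>arcs G. if a = e then edge_tilt G wp wm e t0 l m else 0)) (at t0)"
    by (rule DERIV_sum)
  then show ?thesis
    using networkD(1)[OF net] e by (simp add: tilted_entry_def)
qed

lemma counting_variable_upd: "e \<in> E' \<Longrightarrow> counting_variable E' (q(e := t)) = (counting_variable E' q)(e := t)"
  by (auto simp: counting_variable_def fun_eq_iff)

lemma counting_variable_zero [simp]: "counting_variable E' (\<lambda>_. 0) = (\<lambda>_. 0)"
  by (auto simp: counting_variable_def)

text \<open>Stated at an arbitrary \<open>q\<close>, because the second derivative differentiates
  this formula along a line of counting variables.\<close>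

lemma DERIV_scgf:
  fixes E' q wp wm
  assumes net: "network N G" and pos: "positive_rates G wp wm" and e: "e \<in> E'" "e \<in> arcs G"
  defines "v \<equiv> perron_vector N (tilted_entry G wp wm (counting_variable E' q))"
    and "u \<equiv> perron_vector N (\<lambda>i j. tilted_entry G wp wm (counting_variable E' q) j i)"
  shows "((\<lambda>t. scgf N G E' wp wm (q(e := t))) has_real_derivative
    (wp e * exp (q e) * u (head G e) * v (tail G e) - wm e * exp (- q e) * u (tail G e) * v (head G e)) /
    (\<Sum>i<N. u i * v i)) (at (q e))"
proof -
  let ?W = "\<lambda>t. tilted_entry G wp wm (counting_variable E' (q(e := t)))"
  have dW: "((\<lambda>t. ?W t i j) has_real_derivative edge_tilt G wp wm e (q e) i j) (at (q e))" for i j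
    unfolding counting_variable_upd[OF e(1)] by (rule DERIV_tilted_entry[OF net e(2)])
  obtain l' v' where l': "((\<lambda>t. scgf N G E' wp wm (q(e := t))) has_real_derivative l') (at (q e))"
    and eq: "\<And>i. i < N \<Longrightarrow> (\<Sum>j<N. edge_tilt G wp wm e (q e) i j * perron_vector N (?W (q e)) j) +
      (\<Sum>j<N. ?W (q e) i j * v' j) = l' * perron_vector N (?W (q e)) i + scgf N G E' wp wm (q(e := q e)) * v' i"
    by (rule perron_pair_derivatives[of N ?W, OF perron_matrix_tilted[OF net pos] scgf_perron_pair[OF net pos] dW])
      blast
  note eq = eq[unfolded fun_upd_triv, folded v_def]
  note u = perron_pairD[OF scgf_left_perron_pair[OF net pos, of E' q], folded u_def]
  have "l' * (\<Sum>i<N. u i * v i) = (\<Sum>i<N. u i * (\<Sum>j<N. edge_tilt G wp wm e (q e) i j * v j))"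
    by (rule perron_root_derivative_pairing[OF u(3)]) (use eq in auto)
  moreover have "0 < (\<Sum>i<N. u i * v i)"
    unfolding v_def by (rule perron_pair_pairing_pos[OF scgf_perron_pair[OF net pos] networkD(2)[OF net] u(1)])
  ultimately have "l' = (wp e * exp (q e) * u (head G e) * v (tail G e) -
      wm e * exp (- q e) * u (tail G e) * v (head G e)) / (\<Sum>i<N. u i * v i)"
    unfolding edge_tilt_form[OF net e(2)] by (simp add: field_simps)
  then show ?thesis using l' by simp
qed

section \<open>Responses of stalled currents\<close>

abbreviation stationary_vector ::
    "nat \<Rightarrow> (nat, 'e) pre_digraph \<Rightarrow> ('e \<Rightarrow> real) \<Rightarrow> ('e \<Rightarrow> real) \<Rightarrow> nat \<Rightarrow> real" where
  "stationary_vector N G wp wm \<equiv> perron_vector N (generator_entry G wp wm)"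

lemma scgf_zero:
  assumes net: "network N G" and pos: "positive_rates G wp wm"
  shows "scgf N G E' wp wm (\<lambda>_. 0) = 0"
proof -
  note v = perron_pairD[OF scgf_perron_pair[OF net pos, of E' "\<lambda>_. 0"]]
  show ?thesis
    using generator_column_sum[OF net, of wp wm "stationary_vector N G wp wm"] v(2,3)
    by (simp add: sum_distrib_left[symmetric])
qed

lemma stationary_perron_pair:
  assumes "network N G" "positive_rates G wp wm"
  shows "perron_pair N (generator_entry G wp wm) 0 (stationary_vector N G wp wm)"
  using scgf_perron_pair[OF assms, of "{}" "\<lambda>_. 0"] scgf_zero[OF assms] by simp

lemma generator_left_kernel:
  assumes net: "network N G" and j: "j < N"
  shows "(\<Sum>l<N. generator_entry G wp wm l j) = 0"
  using generator_column_sum[OF net, of wp wm "\<lambda>m. of_bool (m = j)"]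
  by (simp only: sum_of_bool_mult(1)[OF j])

text \<open>Conservation of probability makes the constant vector a left null vector, and
  normalization turns it into \<open>1 / N\<close>.\<close>

lemma left_stationary_vector:
  assumes net: "network N G" and pos: "positive_rates G wp wm" and i: "i < N"
  shows "perron_vector N (\<lambda>i j. generator_entry G wp wm j i) i = 1 / N"
proof (rule perron_pair_vector_unique[OF _ _ _ i])
  show "perron_matrix N (\<lambda>i j. generator_entry G wp wm j i)"
    by (rule perron_matrix_transpose[OF perron_matrix_tilted[OF net pos]])
  show "perron_pair N (\<lambda>i j. generator_entry G wp wm j i) 0 (\<lambda>_. 1 / N)"
    using networkD(2)[OF net] generator_left_kernel[OF net, of _ wp wm]
    by (simp add: perron_pair_def sum_divide_distrib[symmetric])
  show "perron_pair N (\<lambda>i j. generator_entry G wp wm j i) 0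
      (perron_vector N (\<lambda>i j. generator_entry G wp wm j i))"
    using scgf_left_perron_pair[OF net pos, of "{}" "\<lambda>_. 0"] scgf_zero[OF net pos] by simp
qed

text \<open>At zero tilt the left eigenvector is constant, so the perturbation formula for the root
  reduces to the net probability flow through the edge.\<close>

lemma edge_current_eq:
  assumes net: "network N G" and pos: "positive_rates G wp wm" and e: "e \<in> E'" "e \<in> arcs G"
  shows "edge_current N G E' wp wm e = edge_flow G wp wm e (stationary_vector N G wp wm)"
proof -
  let ?v = "stationary_vector N G wp wm"
  let ?u = "perron_vector N (\<lambda>i j. generator_entry G wp wm j i)"
  note N = networkD(2)[OF net] and u = left_stationary_vector[OF net pos]
  have "edge_current N G E' wp wm e =
      (wp e * ?u (head G e) * ?v (tail G e) - wm e * ?u (tail G e) * ?v (head G e)) / (\<Sum>i<N. ?u i * ?v i)"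
    unfolding edge_current_def partial_deriv_def
    using DERIV_imp_deriv[OF DERIV_scgf[OF net pos e, of "\<lambda>_. 0"]] by simp
  also have "(\<Sum>i<N. ?u i * ?v i) = 1 / N"
    using u perron_pairD(2)[OF stationary_perron_pair[OF net pos]]
    by (simp add: sum_divide_distrib[symmetric])
  finally show ?thesis
    using N by (simp add: edge_flow_def u networkD(3,4)[OF net e(2)] diff_divide_distrib left_diff_distrib)
qed

text \<open>The kernel is spanned by the stationary vector, whose sum is \<open>1\<close>. This is
  what makes responses unique.\<close>

lemma generator_kernel_sum_zero:
  assumes net: "network N G" and pos: "positive_rates G wp wm"
    and x: "(\<Sum>i<N. x i) = 0" "\<And>i. i < N \<Longrightarrow> (\<Sum>j<N. generator_entry G wp wm i j * x j) = 0"
    and i: "i < N"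
  shows "x i = 0"
proof -
  note v = perron_pairD[OF stationary_perron_pair[OF net pos]]
  obtain k where k: "\<forall>i<N. x i = k * stationary_vector N G wp wm i"
    using eigenvector_unique[OF perron_matrix_tilted[OF net pos] v(1,3), of x] x(2) by auto
  then have "k = 0" using x(1) v(2) by (simp add: sum_distrib_left[symmetric])
  then show ?thesis using k i by simp
qed

lemma edge_response_unique:
  assumes net: "network N G" and pos: "positive_rates G wp wm"
    and "edge_response N G wp wm p e x" "edge_response N G wp wm p e y" "i < N"
  shows "x i = y i"
proof -
  have "x i - y i = 0"
    by (rule generator_kernel_sum_zero[OF net pos _ _ \<open>i < N\<close>, of "\<lambda>i. x i - y i"])
      (use assms in \<open>simp_all add: edge_response_def sum_subtractf right_diff_distrib\<close>)
  then show ?thesis by simp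
qed

text \<open>Stalling equates the two one-way flows, so both terms carry the same factor and form a
  dipole across the edge.\<close>

lemma edge_tilt_stalled_action:
  assumes net: "network N G" and e: "e \<in> arcs G" and stalled: "edge_flow G wp wm e p = 0"
  shows "(\<Sum>m<N. edge_tilt G wp wm e 0 l m * p m) =
    wp e * p (tail G e) * (of_bool (l = head G e) - of_bool (l = tail G e))"
  using stalled unfolding edge_tilt_action[OF net e] edge_flow_def by (auto simp: algebra_simps)

text \<open>Stalling makes the derivative of the root zero, so that the differentiated eigenvalue
  equation becomes the defining equation of \<open>edge_response\<close>. The left vector is
  differentiated as well, for use in the second derivative.\<close>

lemma stalled_perron_derivatives:
  fixes G :: "(nat, 'e) pre_digraph" and wp wm :: "'e \<Rightarrow> real" and e :: 'e
  defines "W \<equiv> \<lambda>t. tilted_entry G wp wm ((\<lambda>_. 0)(e := t))"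
  assumes net: "network N G" and pos: "positive_rates G wp wm" and e: "e \<in> arcs G"
    and stalled: "edge_flow G wp wm e (stationary_vector N G wp wm) = 0"
  obtains v' u' where
    "\<And>i. i < N \<Longrightarrow> ((\<lambda>t. perron_vector N (W t) i) has_real_derivative v' i) (at 0)"
    "edge_response N G wp wm (stationary_vector N G wp wm) e v'"
    "\<And>i. i < N \<Longrightarrow> ((\<lambda>t. perron_vector N (\<lambda>i j. W t j i) i) has_real_derivative u' i) (at 0)"
    "\<And>j. j < N \<Longrightarrow> (\<Sum>i<N. edge_tilt G wp wm e 0 i j) / N + (\<Sum>i<N. generator_entry G wp wm i j * u' i) = 0"
proof -
  let ?p = "stationary_vector N G wp wm"
  define l where "l t = scgf N G {e} wp wm ((\<lambda>_. 0)(e := t))" for t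
  have cv: "counting_variable {e} ((\<lambda>_. 0)(e := t)) = (\<lambda>_. 0)(e := t)" for t :: real
    by (simp add: counting_variable_upd)
  have l0: "l 0 = 0" using scgf_zero[OF net pos, of "{e}"] by (simp add: l_def fun_upd_idem)
  have W0: "W 0 = generator_entry G wp wm" by (simp add: W_def fun_upd_idem)
  have irr: "perron_matrix N (W t)" for t unfolding W_def by (rule perron_matrix_tilted[OF net pos])
  have v: "perron_pair N (W t) (l t) (perron_vector N (W t))" for t
    using scgf_perron_pair[OF net pos, of "{e}"] unfolding W_def l_def by (metis cv)
  have u: "perron_pair N (\<lambda>i j. W t j i) (l t) (perron_vector N (\<lambda>i j. W t j i))" for t
    using scgf_left_perron_pair[OF net pos, of "{e}" "(\<lambda>_. 0)(e := t)"] unfolding W_def l_def cv .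
  have dW: "((\<lambda>t. W t i j) has_real_derivative edge_tilt G wp wm e 0 i j) (at 0)" for i j
    unfolding W_def by (rule DERIV_tilted_entry[OF net e])
  obtain l' v' where l': "(l has_real_derivative l') (at 0)"
    and v': "\<And>i. i < N \<Longrightarrow> ((\<lambda>t. perron_vector N (W t) i) has_real_derivative v' i) (at 0)"
    and v'0: "(\<Sum>i<N. v' i) = 0"
    and v'eq: "\<And>i. i < N \<Longrightarrow> (\<Sum>j<N. edge_tilt G wp wm e 0 i j * perron_vector N (W 0) j) +
      (\<Sum>j<N. W 0 i j * v' j) = l' * perron_vector N (W 0) i + l 0 * v' i"
    by (rule perron_pair_derivatives[OF irr v dW]) blast
  note v'eq = v'eq[unfolded W0 l0]
  \<comment> \<open>Summing the rows isolates \<open>l'\<close>: the generator part vanishes by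
    conservation, and the tilt part is the flow of the stalled edge.\<close>
  have "(\<Sum>i<N. (\<Sum>j<N. edge_tilt G wp wm e 0 i j * ?p j) + (\<Sum>j<N. generator_entry G wp wm i j * v' j))
      = l' * (\<Sum>i<N. ?p i)"
    using v'eq by (simp add: sum_distrib_left)
  moreover have "(\<Sum>i<N. \<Sum>j<N. edge_tilt G wp wm e 0 i j * ?p j) = 0"
    using edge_tilt_form[OF net e, of "\<lambda>_. 1" wp wm 0 ?p] stalled by (simp add: edge_flow_def)
  ultimately have "l' = 0"
    using generator_column_sum[OF net, of wp wm v'] perron_pairD(2)[OF stationary_perron_pair[OF net pos]]
    by (simp add: sum.distrib)
  obtain k' u' where k': "(l has_real_derivative k') (at 0)"
    and u': "\<And>i. i < N \<Longrightarrow> ((\<lambda>t. perron_vector N (\<lambda>i j. W t j i) i) has_real_derivative u' i) (at 0)"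
    and u'eq: "\<And>i. i < N \<Longrightarrow> (\<Sum>j<N. edge_tilt G wp wm e 0 j i * perron_vector N (\<lambda>i j. W 0 j i) j) +
      (\<Sum>j<N. W 0 j i * u' j) = k' * perron_vector N (\<lambda>i j. W 0 j i) i + l 0 * u' i"
    by (rule perron_pair_derivatives[OF perron_matrix_transpose[OF irr] u dW]) blast
  have "k' = 0" using DERIV_unique[OF k' l'] \<open>l' = 0\<close> by simp
  have u'_eq: "(\<Sum>i<N. edge_tilt G wp wm e 0 i j) / N + (\<Sum>i<N. generator_entry G wp wm i j * u' i) = 0"
    if j: "j < N" for j
  proof -
    have "(\<Sum>i<N. edge_tilt G wp wm e 0 i j * perron_vector N (\<lambda>i j. generator_entry G wp wm j i) i)
        = (\<Sum>i<N. edge_tilt G wp wm e 0 i j) / N"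
      using left_stationary_vector[OF net pos] by (simp add: sum_divide_distrib)
    then show ?thesis using u'eq[OF j, unfolded W0 l0 \<open>k' = 0\<close>] by simp
  qed
  have "edge_response N G wp wm ?p e v'"
    using v'0 v'eq unfolding edge_response_def edge_tilt_stalled_action[OF net e stalled] \<open>l' = 0\<close>
    by (simp add: eq_neg_iff_add_eq_0 add.commute)
  then show ?thesis using that v' u' u'_eq by blast
qed

text \<open>The first derivative in \<open>e'\<close> is a quotient built from left and right Perron
  vectors, to be differentiated in the counting variable of \<open>e\<close>. The right vector
  responds by \<open>x\<close>; the left response is converted into the flow of \<open>e\<close> in
  the response \<open>y\<close>.\<close>

lemma scgf_second_derivative:
  fixes N G E' wp wm
  defines "p \<equiv> stationary_vector N G wp wm"
  assumes net: "network N G" and pos: "positive_rates G wp wm"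
    and e: "e \<in> E'" "e \<in> arcs G" and e': "e' \<in> E'" "e' \<in> arcs G"
    and stalled: "edge_flow G wp wm e p = 0" "edge_flow G wp wm e' p = 0"
    and x: "edge_response N G wp wm p e x" and y: "edge_response N G wp wm p e' y"
  shows "partial_deriv e (partial_deriv e' (scgf N G E' wp wm)) (\<lambda>_. 0) =
    2 * of_bool (e = e') * (wp e * p (tail G e)) + edge_flow G wp wm e' x + edge_flow G wp wm e y"
proof -
  define W where "W t = tilted_entry G wp wm ((\<lambda>_. 0)(e := t))" for t
  define V U where "V t i = perron_vector N (W t) i" and "U t i = perron_vector N (\<lambda>i j. W t j i) i" for t i
  \<comment> \<open>Along the line the tilt of \<open>e'\<close> is \<open>t\<close> when the edges
    coincide and \<open>0\<close> otherwise.\<close>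
  define g where "g t = ((\<lambda>_. 0)(e := t)) e'" for t :: real
  define h k where "h = head G e'" and "k = tail G e'"
  have hk: "h < N" "k < N" using networkD(3,4)[OF net e'(2)] by (auto simp: h_def k_def)
  have N: "0 < N" by (rule networkD(2)[OF net])
  have cv: "counting_variable E' ((\<lambda>_. 0)(e := t)) = (\<lambda>_. 0)(e := t)" for t :: real
    by (simp add: counting_variable_upd[OF e(1)])
  have W0: "W 0 = generator_entry G wp wm" by (simp add: W_def fun_upd_idem)
  have V0: "V 0 = p" by (simp add: V_def W0 p_def fun_eq_iff)
  have U0: "U 0 i = 1 / N" if "i < N" for i
    using left_stationary_vector[OF net pos that] by (simp add: U_def W0)
  have g0: "g 0 = 0" by (simp add: g_def)
  have g': "(g has_real_derivative of_bool (e = e')) (at 0)"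
  proof -
    have "g = (if e = e' then (\<lambda>t. t) else (\<lambda>_. 0))" by (auto simp: g_def fun_eq_iff)
    then show ?thesis by simp
  qed
  obtain V' U' where V': "\<And>i. i < N \<Longrightarrow> ((\<lambda>t. V t i) has_real_derivative V' i) (at 0)"
    and resp: "edge_response N G wp wm p e V'"
    and U': "\<And>i. i < N \<Longrightarrow> ((\<lambda>t. U t i) has_real_derivative U' i) (at 0)"
    and U'_eq: "\<And>j. j < N \<Longrightarrow> (\<Sum>i<N. edge_tilt G wp wm e 0 i j) / N +
      (\<Sum>i<N. generator_entry G wp wm i j * U' i) = 0"
    using stalled_perron_derivatives[OF net pos e(2) stalled(1)[unfolded p_def]]
    unfolding V_def U_def W_def p_def by blast
  have V'x: "V' i = x i" if "i < N" for i
    by (rule edge_response_unique[OF net pos resp x that])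
  define num where "num t = wp e' * exp (g t) * U t h * V t k - wm e' * exp (- g t) * U t k * V t h" for t
  define den where "den t = (\<Sum>i<N. U t i * V t i)" for t
  have "partial_deriv e' (scgf N G E' wp wm) ((\<lambda>_. 0)(e := t)) = num t / den t" for t
    unfolding partial_deriv_def num_def den_def g_def U_def V_def W_def h_def k_def
    using DERIV_imp_deriv[OF DERIV_scgf[OF net pos e', of "(\<lambda>_. 0)(e := t)"]] unfolding cv .
  then have "partial_deriv e (partial_deriv e' (scgf N G E' wp wm)) (\<lambda>_. 0) = deriv (\<lambda>t. num t / den t) 0"
    by (simp add: partial_deriv_def[of e])
  also have "\<dots> = 2 * of_bool (e = e') * (wp e * p (tail G e)) + edge_flow G wp wm e' x + edge_flow G wp wm e y"
  proof -
    have st: "wp e' * p k = wm e' * p h" using stalled(2) by (simp add: edge_flow_def h_def k_def)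
    have num0: "num 0 = 0" using st hk by (simp add: num_def g0 V0 U0)
    have den0: "den 0 = 1 / N"
      using perron_pairD(2)[OF stationary_perron_pair[OF net pos]]
      by (simp add: den_def V0 U0 p_def sum_divide_distrib[symmetric])
    have "(den has_real_derivative (\<Sum>i<N. U' i * V 0 i + V' i * U 0 i)) (at 0)"
      unfolding den_def using U' V' by (intro DERIV_sum DERIV_mult) auto
    moreover have "(num has_real_derivative
        (wp e' * of_bool (e = e') * U 0 h * V 0 k + wp e' * U' h * V 0 k + wp e' * U 0 h * V' k) -
        (- (wm e' * of_bool (e = e') * U 0 k * V 0 h) + wm e' * U' k * V 0 h + wm e' * U 0 k * V' h)) (at 0)"
      unfolding num_def using g' U'[OF hk(1)] U'[OF hk(2)] V'[OF hk(1)] V'[OF hk(2)]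
      by (auto intro!: derivative_eq_intros simp: g0 algebra_simps)
    \<comment> \<open>As \<open>num\<close> vanishes at \<open>0\<close>, the quotient rule leaves
      its derivative divided by \<open>den 0 = 1 / N\<close>.\<close>
    ultimately have "((\<lambda>t. num t / den t) has_real_derivative
        N * ((wp e' * of_bool (e = e') * U 0 h * V 0 k + wp e' * U' h * V 0 k + wp e' * U 0 h * V' k) -
        (- (wm e' * of_bool (e = e') * U 0 k * V 0 h) + wm e' * U' k * V 0 h + wm e' * U 0 k * V' h))) (at 0)"
      using N by (auto intro!: DERIV_cong[OF DERIV_divide] simp: num0 den0)
    then have "deriv (\<lambda>t. num t / den t) 0 =
        N * ((wp e' * of_bool (e = e') * U 0 h * V 0 k + wp e' * U' h * V 0 k + wp e' * U 0 h * V' k) -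
        (- (wm e' * of_bool (e = e') * U 0 k * V 0 h) + wm e' * U' k * V 0 h + wm e' * U 0 k * V' h))"
      by (rule DERIV_imp_deriv)
    also have "\<dots> = of_bool (e = e') * (wp e' * p k + wm e' * p h) + (wp e' * x k - wm e' * x h)
        + N * (U' h * (wp e' * p k) - U' k * (wm e' * p h))"
      using N by (simp add: V0 U0 hk V'x field_simps)
    also have "U' h * (wp e' * p k) - U' k * (wm e' * p h) = wp e' * p k * (U' h - U' k)"
      unfolding st[symmetric] by (simp add: algebra_simps)
    \<comment> \<open>The left response \<open>U'\<close> is tested against the dipole of
      \<open>e'\<close>, which up to sign is the generator applied to \<open>y\<close>. Moving the
      generator onto \<open>U'\<close> and inserting the equation of \<open>U'\<close> leaves the
      column sums of \<open>edge_tilt\<close> paired with \<open>y\<close>, that is, the flow of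
      \<open>e\<close>.\<close>
    also have "N * (wp e' * p k * (U' h - U' k)) = edge_flow G wp wm e y"
    proof -
      have "wp e' * p k * (U' h - U' k)
          = - (\<Sum>i<N. U' i * (- (wp e' * p k) * (of_bool (i = h) - of_bool (i = k))))"
      proof -
        have "(\<Sum>i<N. U' i * (- (wp e' * p k) * (of_bool (i = h) - of_bool (i = k))))
            = (\<Sum>i<N. (- (wp e' * p k) * U' i) * of_bool (i = h)) - (\<Sum>i<N. (- (wp e' * p k) * U' i) * of_bool (i = k))"
          unfolding sum_subtractf[symmetric] by (rule sum.cong) (simp_all add: algebra_simps)
        then show ?thesis
          by (simp only: sum_of_bool_mult(1)[OF hk(1)] sum_of_bool_mult(1)[OF hk(2)]) (simp add: algebra_simps)
      qed
      also have "\<dots> = - (\<Sum>i<N. U' i * (\<Sum>j<N. generator_entry G wp wm i j * y j))"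
        using y by (simp add: edge_response_def h_def k_def)
      also have "\<dots> = - (\<Sum>j<N. (\<Sum>i<N. generator_entry G wp wm i j * U' i) * y j)"
        by (simp only: left_right_pairing)
      also have "\<dots> = (\<Sum>j<N. (\<Sum>i<N. edge_tilt G wp wm e 0 i j) / N * y j)"
        unfolding sum_negf[symmetric]
        by (rule sum.cong) (use U'_eq in \<open>auto simp: add_eq_0_iff\<close>)
      also have "\<dots> = (\<Sum>j<N. (\<Sum>i<N. edge_tilt G wp wm e 0 i j * 1) * y j) / N"
        by (subst sum_divide_distrib) simp
      also have "\<dots> = (\<Sum>i<N. 1 * (\<Sum>j<N. edge_tilt G wp wm e 0 i j * y j)) / N"
        by (simp only: left_right_pairing)
      also have "\<dots> = edge_flow G wp wm e y / N"
        unfolding edge_tilt_form[OF net e(2)] by (simp add: edge_flow_def)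
      finally show ?thesis using N by simp
    qed
    \<comment> \<open>When the edges coincide, stalling makes the two one-way flows equal, whence
      the factor \<open>2\<close>.\<close>
    also have "of_bool (e = e') * (wp e' * p k + wm e' * p h) = 2 * of_bool (e = e') * (wp e * p (tail G e))"
      using st by (auto simp: k_def)
    finally show ?thesis by (simp add: edge_flow_def h_def k_def)
  qed
  finally show ?thesis .
qed

text \<open>By \<open>flow\<close>, the changing rates of an edge \<open>f\<close> act on
  \<open>p\<close> like \<open>c f\<close> times its counting derivative. By linearity the
  stationary vector responds by the combination of the \<open>x f\<close> with coefficients
  \<open>c f\<close>, and the product rule adds the direct change of the rates of
  \<open>e\<close>.\<close>

lemma DERIV_edge_current:
  fixes wp wm :: "real \<Rightarrow> 'e \<Rightarrow> real" and N G t0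
  defines "p \<equiv> stationary_vector N G (wp t0) (wm t0)"
  assumes net: "network N G" and pos: "\<And>t. positive_rates G (wp t) (wm t)" and E': "E' \<subseteq> arcs G"
    and dwp: "\<And>e. e \<in> arcs G \<Longrightarrow> ((\<lambda>t. wp t e) has_real_derivative dp e) (at t0)"
    and dwm: "\<And>e. e \<in> arcs G \<Longrightarrow> ((\<lambda>t. wm t e) has_real_derivative dm e) (at t0)"
    and flow: "\<And>e. e \<in> E' \<Longrightarrow> edge_flow G dp dm e p = c e * (wp t0 e * p (tail G e))"
    and outside: "\<And>e. e \<in> arcs G - E' \<Longrightarrow> dp e = 0 \<and> dm e = 0"
    and x: "\<And>f. f \<in> E' \<Longrightarrow> edge_response N G (wp t0) (wm t0) p f (x f)"
    and e: "e \<in> E'"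
  shows "((\<lambda>t. edge_current N G E' (wp t) (wm t) e) has_real_derivative
    c e * (wp t0 e * p (tail G e)) + (\<Sum>f\<in>E'. c f * edge_flow G (wp t0) (wm t0) e (x f))) (at t0)"
proof -
  let ?W = "\<lambda>t. generator_entry G (wp t) (wm t)"
  let ?p = "\<lambda>t. stationary_vector N G (wp t) (wm t)"
  have fin: "finite (arcs G)" "finite E'"
    using networkD(1)[OF net] E' finite_subset by auto
  have dW: "((\<lambda>t. ?W t i j) has_real_derivative generator_entry G dp dm i j) (at t0)" for i j
    unfolding tilted_entry_def
    by (intro DERIV_sum DERIV_add DERIV_cmult_right dwp dwm)
  obtain l' p' where l': "((\<lambda>_. 0) has_real_derivative l') (at t0)"
    and p': "\<And>i. i < N \<Longrightarrow> ((\<lambda>t. ?p t i) has_real_derivative p' i) (at t0)"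
    and p'0: "(\<Sum>i<N. p' i) = 0"
    and p'eq: "\<And>i. i < N \<Longrightarrow> (\<Sum>j<N. generator_entry G dp dm i j * ?p t0 j) + (\<Sum>j<N. ?W t0 i j * p' j)
      = l' * ?p t0 i + 0 * p' i"
    by (rule perron_pair_derivatives[of N ?W "\<lambda>_. 0" ?p, OF perron_matrix_tilted[OF net pos]
          stationary_perron_pair[OF net pos] dW]) blast
  have "l' = 0" using DERIV_unique[OF l' DERIV_const] .
  have dWp: "(\<Sum>j<N. generator_entry G dp dm i j * p j) =
      (\<Sum>f\<in>E'. c f * (wp t0 f * p (tail G f) * (of_bool (i = head G f) - of_bool (i = tail G f))))" for i
    unfolding generator_entry_action[OF net]
    by (rule sum.mono_neutral_cong_right) (use fin E' flow outside in \<open>auto simp: edge_flow_def\<close>)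
  \<comment> \<open>Both sides have sum zero and the same image under the generator.\<close>
  have p'x: "p' i = (\<Sum>f\<in>E'. c f * x f i)" if i: "i < N" for i
  proof -
    have "p' i - (\<Sum>f\<in>E'. c f * x f i) = 0"
    proof (rule generator_kernel_sum_zero[OF net pos _ _ i, of "\<lambda>i. p' i - (\<Sum>f\<in>E'. c f * x f i)" t0])
      have "(\<Sum>i<N. \<Sum>f\<in>E'. c f * x f i) = (\<Sum>f\<in>E'. c f * (\<Sum>i<N. x f i))"
        by (subst sum.swap) (simp add: sum_distrib_left)
      then show "(\<Sum>i<N. p' i - (\<Sum>f\<in>E'. c f * x f i)) = 0"
        using x p'0 by (simp add: sum_subtractf edge_response_def)
      fix i assume i: "i < N"
      have "(\<Sum>j<N. ?W t0 i j * (\<Sum>f\<in>E'. c f * x f j)) = (\<Sum>f\<in>E'. c f * (\<Sum>j<N. ?W t0 i j * x f j))"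
        unfolding sum_distrib_left by (subst sum.swap) (simp add: mult_ac)
      also have "\<dots> = - (\<Sum>j<N. generator_entry G dp dm i j * p j)"
        unfolding dWp sum_negf[symmetric]
        by (rule sum.cong) (use x i in \<open>auto simp: edge_response_def\<close>)
      also have "\<dots> = (\<Sum>j<N. ?W t0 i j * p' j)"
        using p'eq[OF i] \<open>l' = 0\<close> by (simp add: p_def)
      finally show "(\<Sum>j<N. ?W t0 i j * (p' j - (\<Sum>f\<in>E'. c f * x f j))) = 0"
        by (simp add: right_diff_distrib sum_subtractf)
    qed
    then show ?thesis by simp
  qed
  have eG: "e \<in> arcs G" using e E' by auto
  note ht = networkD(3,4)[OF net eG]
  have "((\<lambda>t. edge_flow G (wp t) (wm t) e (?p t)) has_real_derivative
      (dp e * p (tail G e) + p' (tail G e) * wp t0 e) - (dm e * p (head G e) + p' (head G e) * wm t0 e)) (at t0)"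
    unfolding edge_flow_def p_def
    by (intro DERIV_diff DERIV_mult dwp dwm p' eG ht)
  moreover have "(dp e * p (tail G e) + p' (tail G e) * wp t0 e) - (dm e * p (head G e) + p' (head G e) * wm t0 e)
      = edge_flow G dp dm e p + edge_flow G (wp t0) (wm t0) e p'"
    by (simp add: edge_flow_def)
  moreover have "edge_flow G (wp t0) (wm t0) e p' = (\<Sum>f\<in>E'. c f * edge_flow G (wp t0) (wm t0) e (x f))"
    unfolding edge_flow_def p'x[OF ht(1)] p'x[OF ht(2)]
    by (simp add: sum_distrib_left sum_subtractf[symmetric] algebra_simps)
  ultimately show ?thesis
    using edge_current_eq[OF net pos e eG] flow[OF e] by simp
qed

text \<open>Here \<open>F e f\<close> stands for the flow of \<open>e\<close> in the response to
  \<open>f\<close>. Exchanging the summation indices in the terms \<open>F f e\<close> splits the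
  sum into two halves, each taking one copy of the diagonal.\<close>

lemma symmetrized_sum:
  fixes a b w :: "'e \<Rightarrow> real" and F :: "'e \<Rightarrow> 'e \<Rightarrow> real"
  assumes "finite E"
  shows "(\<Sum>e\<in>E. \<Sum>f\<in>E. a e * b f * (2 * of_bool (e = f) * w e + F f e + F e f)) =
    (\<Sum>e\<in>E. a e * (b e * w e + (\<Sum>f\<in>E. b f * F e f))) + (\<Sum>e\<in>E. b e * (a e * w e + (\<Sum>f\<in>E. a f * F e f)))"
proof -
  have diag: "(\<Sum>e\<in>E. \<Sum>f\<in>E. a e * b f * (2 * of_bool (e = f) * w e)) = 2 * (\<Sum>e\<in>E. a e * b e * w e)"
  proof -
    have "(\<Sum>f\<in>E. a e * b f * (2 * of_bool (e = f) * w e)) = 2 * (a e * b e * w e)" if "e \<in> E" for e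
    proof -
      have "(\<Sum>f\<in>E. a e * b f * (2 * of_bool (e = f) * w e)) = (\<Sum>f\<in>E. if e = f then 2 * (a e * b e * w e) else 0)"
        by (rule sum.cong) auto
      then show ?thesis using that assms by simp
    qed
    then show ?thesis by (simp add: sum_distrib_left)
  qed
  have swap: "(\<Sum>e\<in>E. \<Sum>f\<in>E. a e * b f * F f e) = (\<Sum>e\<in>E. \<Sum>f\<in>E. b e * (a f * F e f))"
    by (subst sum.swap) (simp add: mult_ac)
  have "(\<Sum>e\<in>E. \<Sum>f\<in>E. a e * b f * (2 * of_bool (e = f) * w e + F f e + F e f)) =
      2 * (\<Sum>e\<in>E. a e * b e * w e) + (\<Sum>e\<in>E. \<Sum>f\<in>E. b e * (a f * F e f)) + (\<Sum>e\<in>E. \<Sum>f\<in>E. a e * (b f * F e f))"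
    unfolding diag[symmetric] swap[symmetric] by (simp add: distrib_left sum.distrib mult.assoc)
  then show ?thesis
    by (simp add: distrib_left sum.distrib sum_distrib_left mult_ac)
qed

lemma DERIV_effective_force:
  assumes "finite A" "a \<in> A"
  shows "((\<lambda>t. effective_force A d (h(a := t)) e) has_real_derivative d a e) (at t0)"
proof -
  have "((\<lambda>t. d b e * (h(a := t)) b) has_real_derivative (if b = a then d a e else 0)) (at t0)" for b
    by (cases "b = a") (auto intro!: derivative_eq_intros)
  then have "((\<lambda>t. \<Sum>b\<in>A. d b e * (h(a := t)) b) has_real_derivative
      (\<Sum>b\<in>A. if b = a then d a e else 0)) (at t0)"
    by (rule DERIV_sum)
  then show ?thesis using assms by (simp add: effective_force_def)
qed

text \<open>With \<open>f x * p = g x * q\<close> as common value, the left side is this value times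
  \<open>f' / f x - g' / g x\<close>, the logarithmic derivative of the ratio. This is where local
  detailed balance meets stalling.\<close>

lemma log_ratio_derivative:
  fixes f g :: "real \<Rightarrow> real"
  assumes f: "(f has_real_derivative f') (at x)" "0 < f x"
    and g: "(g has_real_derivative g') (at x)" "0 < g x"
    and ln: "((\<lambda>y. ln (f y / g y)) has_real_derivative 1) (at x)"
    and eq: "f x * p = g x * q"
  shows "f' * p - g' * q = f x * p"
proof -
  have "((\<lambda>y. ln (f y / g y)) has_real_derivative (1 / (f x / g x) * ((f' * g x - f x * g') / (g x * g x)))) (at x)"
    using f g by (intro DERIV_chain2[OF DERIV_ln_divide DERIV_divide]) auto
  then have "1 / (f x / g x) * ((f' * g x - f x * g') / (g x * g x)) = 1"
    using ln DERIV_unique by blast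
  moreover have "1 / (f x / g x) * ((f' * g x - f x * g') / (g x * g x)) = (f' * g x - f x * g') / (f x * g x)"
    using f(2) g(2) by simp
  ultimately have d: "f' * g x - f x * g' = f x * g x" using f(2) g(2) by simp
  have "g x * (f' * p - g' * q) = (f' * g x - f x * g') * p + g' * (f x * p - g x * q)"
    by (simp add: algebra_simps)
  also have "\<dots> = g x * (f x * p)" using d eq by simp
  finally show ?thesis using g(2) by simp
qed

theorem theorem2:
  fixes N :: nat
    and G :: "(nat, 'e) pre_digraph"
    and A :: "'a set"
    and d :: "'a \<Rightarrow> 'e \<Rightarrow> real"
    and wp wm :: "('a \<Rightarrow> real) \<Rightarrow> 'e \<Rightarrow> real"
    and rp rm :: "'e \<Rightarrow> real \<Rightarrow> real"
    and hs :: "'a \<Rightarrow> real"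
  defines "E' \<equiv> contributing_edges G A d"
  defines "J \<equiv> \<lambda>\<alpha> h. physical_current N G A d (wp h) (wm h) \<alpha>"
  defines "D \<equiv> \<lambda>\<alpha> \<alpha>' h. physical_diffusion N G A d (wp h) (wm h) \<alpha> \<alpha>'"
  assumes network: "network N G"
    and finite_A: "finite A"
    and rates_pos: "\<And>h e. e \<in> arcs G \<Longrightarrow> wp h e > 0 \<and> wm h e > 0"
    and locality: "\<And>h h' e. e \<in> arcs G - E' \<Longrightarrow> wp h e = wp h' e \<and> wm h e = wm h' e"
    and through_x: "\<And>h e. e \<in> E' \<Longrightarrow>
          wp h e = rp e (effective_force A d h e) \<and> wm h e = rm e (effective_force A d h e)"
    and r_pos: "\<And>e x. e \<in> E' \<Longrightarrow> rp e x > 0 \<and> rm e x > 0"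
    and r_diff: "\<And>e x. e \<in> E' \<Longrightarrow> rp e differentiable (at x) \<and> rm e differentiable (at x)"
    and local_detailed_balance:
          "\<And>e x. e \<in> E' \<Longrightarrow> ((\<lambda>y. ln (rp e y / rm e y)) has_real_derivative 1) (at x)"
    and stalling: "\<And>e. e \<in> E' \<Longrightarrow> edge_current N G E' (wp hs) (wm hs) e = 0"
  shows "(\<forall>\<alpha>\<in>A. \<forall>\<alpha>'\<in>A.
            partially_differentiable \<alpha>' (J \<alpha>) hs \<and>
            2 * D \<alpha> \<alpha>' hs = partial_deriv \<alpha>' (J \<alpha>) hs + partial_deriv \<alpha> (J \<alpha>') hs) \<and>
         (\<forall>\<alpha>\<in>A. partial_deriv \<alpha> (J \<alpha>) hs = D \<alpha> \<alpha> hs)"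
proof -
  have E'_arcs: "E' \<subseteq> arcs G" by (auto simp: E'_def contributing_edges_def current_support_def)
  have fin: "finite E'" using networkD(1)[OF network] E'_arcs finite_subset by auto
  have pos: "positive_rates G (wp h) (wm h)" for h using rates_pos by (auto simp: positive_rates_def)
  define p where "p = stationary_vector N G (wp hs) (wm hs)"
  define flux where "flux e = wp hs e * p (tail G e)" for e
  have stalled: "edge_flow G (wp hs) (wm hs) e p = 0" if "e \<in> E'" for e
  proof -
    have "edge_current N G E' (wp hs) (wm hs) e = edge_flow G (wp hs) (wm hs) e p"
      unfolding p_def by (rule edge_current_eq[OF network pos that subsetD[OF E'_arcs that]])
    then show ?thesis by (simp only: stalling[OF that])
  qed
  have "\<exists>x. edge_response N G (wp hs) (wm hs) p e x" if "e \<in> E'" for e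
    unfolding p_def
    by (rule stalled_perron_derivatives[OF network pos subsetD[OF E'_arcs that] stalled[OF that, unfolded p_def]])
      (rule exI)
  then obtain x where x: "\<And>e. e \<in> E' \<Longrightarrow> edge_response N G (wp hs) (wm hs) p e (x e)" by metis
  \<comment> \<open>The diffusivity will contain this matrix symmetrized, the force derivative of a
    current the matrix itself.\<close>
  define F where "F e f = edge_flow G (wp hs) (wm hs) e (x f)" for e f
  have DJ: "((\<lambda>t. J \<alpha> (hs(\<beta> := t))) has_real_derivative
      (\<Sum>e\<in>E'. d \<alpha> e * (d \<beta> e * flux e + (\<Sum>f\<in>E'. d \<beta> f * F e f)))) (at (hs \<beta>))"
    if \<beta>: "\<beta> \<in> A" for \<alpha> \<beta>
  proof -
    define X where "X e = effective_force A d hs e" for e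
    \<comment> \<open>Chain rule: the effective force on \<open>e\<close> grows at rate
      \<open>d \<beta> e\<close> with the force \<open>\<beta>\<close>. Off \<open>E'\<close>
      locality makes the derivatives zero.\<close>
    define dp dm where "dp e = (if e \<in> E' then deriv (rp e) (X e) * d \<beta> e else 0)"
      and "dm e = (if e \<in> E' then deriv (rm e) (X e) * d \<beta> e else 0)" for e
    have drp: "(rp e has_real_derivative deriv (rp e) (X e)) (at (X e))"
      and drm: "(rm e has_real_derivative deriv (rm e) (X e)) (at (X e))" if "e \<in> E'" for e
      using r_diff[OF that] by (auto simp: DERIV_deriv_iff_real_differentiable)
    note force = DERIV_effective_force[OF finite_A \<beta>, of d hs _ "hs \<beta>"]
    have dwp: "((\<lambda>t. wp (hs(\<beta> := t)) e) has_real_derivative dp e) (at (hs \<beta>))"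
      and dwm: "((\<lambda>t. wm (hs(\<beta> := t)) e) has_real_derivative dm e) (at (hs \<beta>))" if e: "e \<in> arcs G" for e
    proof -
      have "((\<lambda>t. wp (hs(\<beta> := t)) e) has_real_derivative dp e) (at (hs \<beta>)) \<and>
        ((\<lambda>t. wm (hs(\<beta> := t)) e) has_real_derivative dm e) (at (hs \<beta>))"
      proof (cases "e \<in> E'")
        case True
        have X: "X e = effective_force A d (hs(\<beta> := hs \<beta>)) e" by (simp add: X_def)
        show ?thesis
          using DERIV_chain2[OF drp[OF True, unfolded X] force]
            DERIV_chain2[OF drm[OF True, unfolded X] force] True
          by (simp add: through_x dp_def dm_def X_def)
      next
        case False
        then have "wp (hs(\<beta> := t)) e = wp hs e" "wm (hs(\<beta> := t)) e = wm hs e" for t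
          using locality e by auto
        then show ?thesis using False by (simp add: dp_def dm_def)
      qed
      then show "((\<lambda>t. wp (hs(\<beta> := t)) e) has_real_derivative dp e) (at (hs \<beta>))"
        and "((\<lambda>t. wm (hs(\<beta> := t)) e) has_real_derivative dm e) (at (hs \<beta>))" by auto
    qed
    \<comment> \<open>At a stalled edge the force acts on \<open>p\<close> as the counting variable
      does, scaled by \<open>d \<beta> e\<close>.\<close>
    have flow: "edge_flow G dp dm e p = d \<beta> e * flux e" if e: "e \<in> E'" for e
    proof -
      have "deriv (rp e) (X e) * p (tail G e) - deriv (rm e) (X e) * p (head G e) = rp e (X e) * p (tail G e)"
        by (rule log_ratio_derivative[OF drp[OF e] _ drm[OF e] _ local_detailed_balance[OF e]])
          (use r_pos[OF e] stalled[OF e] through_x[OF e] in \<open>auto simp: edge_flow_def X_def\<close>)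
      then have "d \<beta> e * (deriv (rp e) (X e) * p (tail G e) - deriv (rm e) (X e) * p (head G e)) = d \<beta> e * flux e"
        using through_x[OF e] by (simp add: flux_def X_def)
      then show ?thesis using e by (simp add: edge_flow_def dp_def dm_def algebra_simps)
    qed
    have "((\<lambda>t. edge_current N G E' (wp (hs(\<beta> := t))) (wm (hs(\<beta> := t))) e) has_real_derivative
        (d \<beta> e * flux e + (\<Sum>f\<in>E'. d \<beta> f * F e f))) (at (hs \<beta>))" if e: "e \<in> E'" for e
      using DERIV_edge_current[of N G "\<lambda>t. wp (hs(\<beta> := t))" "\<lambda>t. wm (hs(\<beta> := t))" E' dp "hs \<beta>" dm "d \<beta>" x e,
          OF network pos E'_arcs dwp dwm] flow x e
      by (simp add: p_def flux_def F_def dp_def dm_def)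
    then have "((\<lambda>t. \<Sum>e\<in>E'. d \<alpha> e * edge_current N G E' (wp (hs(\<beta> := t))) (wm (hs(\<beta> := t))) e)
        has_real_derivative (\<Sum>e\<in>E'. d \<alpha> e * (d \<beta> e * flux e + (\<Sum>f\<in>E'. d \<beta> f * F e f)))) (at (hs \<beta>))"
      by (intro DERIV_sum DERIV_cmult)
    then show ?thesis by (simp add: J_def physical_current_def E'_def Let_def)
  qed
  have pd: "partial_deriv \<beta> (J \<alpha>) hs = (\<Sum>e\<in>E'. d \<alpha> e * (d \<beta> e * flux e + (\<Sum>f\<in>E'. d \<beta> f * F e f)))"
    if "\<beta> \<in> A" for \<alpha> \<beta>
    unfolding partial_deriv_def by (rule DERIV_imp_deriv[OF DJ[OF that]])
  have "2 * D \<alpha> \<beta> hs = (\<Sum>e\<in>E'. \<Sum>f\<in>E'. d \<alpha> e * d \<beta> f * (2 * of_bool (e = f) * flux e + F f e + F e f))"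
    for \<alpha> \<beta>
  proof -
    have "2 * edge_diffusivity N G E' (wp hs) (wm hs) e f = 2 * of_bool (e = f) * flux e + F f e + F e f"
      if "e \<in> E'" "f \<in> E'" for e f
      unfolding edge_diffusivity_def flux_def F_def p_def
      using scgf_second_derivative[OF network pos that(1) subsetD[OF E'_arcs that(1)] that(2) subsetD[OF E'_arcs that(2)]
          stalled(1)[OF that(1), unfolded p_def] stalled(1)[OF that(2), unfolded p_def]
          x[OF that(1), unfolded p_def] x[OF that(2), unfolded p_def]]
      by simp
    moreover have "2 * D \<alpha> \<beta> hs
        = (\<Sum>e\<in>E'. \<Sum>f\<in>E'. d \<alpha> e * d \<beta> f * (2 * edge_diffusivity N G E' (wp hs) (wm hs) e f))"
      by (simp add: D_def physical_diffusion_def E'_def Let_def sum_distrib_left mult_ac)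
    ultimately show ?thesis by simp
  qed
  then have main: "2 * D \<alpha> \<beta> hs = partial_deriv \<beta> (J \<alpha>) hs + partial_deriv \<alpha> (J \<beta>) hs"
    if "\<alpha> \<in> A" "\<beta> \<in> A" for \<alpha> \<beta>
    unfolding pd[OF that(1)] pd[OF that(2)] using symmetrized_sum[OF fin] by simp
  \<comment> \<open>As \<open>deriv\<close> is a total function, this certifies that the partial
    derivatives above are genuine.\<close>
  have "partially_differentiable \<beta> (J \<alpha>) hs" if "\<beta> \<in> A" for \<alpha> \<beta>
    unfolding partially_differentiable_def using DJ[OF that] unfolding real_differentiable_def by blast
  moreover have "partial_deriv \<alpha> (J \<alpha>) hs = D \<alpha> \<alpha> hs" if "\<alpha> \<in> A" for \<alpha>
    using main[OF that that] by simp
  ultimately show ?thesis using main by blast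
qed

end
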